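(* There exists a polynomial-time algorithm which, given a cograph $G$, computes its tensor capacity $\Theta^T(G)$.
   Context: A cograph is a graph with no induced path on four vertices. For graphs $G$ and $H$, the categorical (tensor) product $G \times H$ has vertex set $V(G)\times V(H)$, and $(g_1,h_1)$ is adjacent to $(g_2,h_2)$ iff $\{g_1,g_2\}\in E(G)$ and $\{h_1,h_2\}\in E(H)$. $G^k$ denotes the $k$-fold categorical power $G\times\cdots\times G$. The independence ratio is $i(G)=\alpha(G)/|V(G)|$, and the tensor capacity (ultimate categorical independence ratio) is $\Theta^T(G)=\lim_{k\to\infty} i(G^k)$ (the sequence is non-decreasing and bounded by $1$). *)

theory Defs
  imports
    Complex_Main
    "HOL-Library.Discrete_Functions"
    "HOL-Computational_Algebra.Polynomial"
    "Graph_Theory.Pair_Digraph"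
begin

section \<open>Cographs and tensor capacity\<close>

text \<open>
  Finite simple graphs are elements of the locale \<^locale>\<open>pair_graph\<close>: an undirected edge
  \<open>{u, v}\<close> is the pair of arcs \<open>(u, v)\<close> and \<open>(v, u)\<close>.
\<close>

definition induced_P4 :: "'a pair_pre_digraph \<Rightarrow> 'a \<Rightarrow> 'a \<Rightarrow> 'a \<Rightarrow> 'a \<Rightarrow> bool" where
  "induced_P4 G a b c d \<longleftrightarrow>
     distinct [a, b, c, d] \<and> {a, b, c, d} \<subseteq> pverts G \<and>
     (a, b) \<in> parcs G \<and> (b, c) \<in> parcs G \<and> (c, d) \<in> parcs G \<and>
     (a, c) \<notin> parcs G \<and> (a, d) \<notin> parcs G \<and> (b, d) \<notin> parcs G"

definition cograph :: "'a pair_pre_digraph \<Rightarrow> bool" where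
  "cograph G \<longleftrightarrow> pair_graph G \<and> \<not> (\<exists>a b c d. induced_P4 G a b c d)"

definition independent_set :: "'a pair_pre_digraph \<Rightarrow> 'a set \<Rightarrow> bool" where
  "independent_set G S \<longleftrightarrow> S \<subseteq> pverts G \<and> (\<forall>u\<in>S. \<forall>v\<in>S. (u, v) \<notin> parcs G)"

definition independence_number :: "'a pair_pre_digraph \<Rightarrow> nat" where
  "independence_number G = Max {card S |S. independent_set G S}"

definition independence_ratio :: "'a pair_pre_digraph \<Rightarrow> real" where
  "independence_ratio G = real (independence_number G) / real (card (pverts G))"

definition tensor_product ::
    "'a pair_pre_digraph \<Rightarrow> 'b pair_pre_digraph \<Rightarrow> ('a \<times> 'b) pair_pre_digraph" where
  "tensor_product G H =
     \<lparr> pverts = pverts G \<times> pverts H,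
       parcs = {((g1, h1), (g2, h2)) |g1 h1 g2 h2. (g1, g2) \<in> parcs G \<and> (h1, h2) \<in> parcs H} \<rparr>"

text \<open>
  The vertices of the \<open>k\<close>-fold power are the lists of length \<open>k\<close>, so that all powers have the
  same type. The power for \<open>k = 0\<close> is the neutral element of the product, a single vertex with
  a loop; it plays no role in the limit below.
\<close>

definition tensor_power :: "'a pair_pre_digraph \<Rightarrow> nat \<Rightarrow> 'a list pair_pre_digraph" where
  "tensor_power G k =
     \<lparr> pverts = {xs. length xs = k \<and> set xs \<subseteq> pverts G},
       parcs = {(xs, ys). length xs = k \<and> list_all2 (\<lambda>u v. (u, v) \<in> parcs G) xs ys} \<rparr>"

definition tensor_capacity :: "'a pair_pre_digraph \<Rightarrow> real" where
  "tensor_capacity G = lim (\<lambda>k. independence_ratio (tensor_power G k))"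

lemma pverts_tensor_power_Suc:
  "pverts (tensor_power G (Suc k)) =
     (\<lambda>(x, xs). x # xs) ` pverts (tensor_product G (tensor_power G k))"
  by (force simp: tensor_power_def tensor_product_def length_Suc_conv image_iff)

lemma parcs_tensor_power_Suc:
  "parcs (tensor_power G (Suc k)) =
     map_prod (\<lambda>(x, xs). x # xs) (\<lambda>(x, xs). x # xs) `
       parcs (tensor_product G (tensor_power G k))"
  by (force simp: tensor_power_def tensor_product_def length_Suc_conv image_iff list_all2_Cons1)

lemma finite_pverts_tensor_power:
  "finite (pverts G) \<Longrightarrow> finite (pverts (tensor_power G k))"
  using finite_lists_length_eq[of "pverts G" k] by (simp add: tensor_power_def conj_commute)

lemma card_pverts_tensor_power:
  "finite (pverts G) \<Longrightarrow> card (pverts (tensor_power G k)) = card (pverts G) ^ k"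
  using card_lists_length_eq[of "pverts G" k] by (simp add: tensor_power_def conj_commute)

lemma finite_independent_cards:
  assumes "finite (pverts G)"
  shows "finite {card S |S. independent_set G S}"
proof -
  have "{card S |S. independent_set G S} \<subseteq> card ` Pow (pverts G)"
    by (auto simp: independent_set_def)
  then show ?thesis
    using assms finite_subset by blast
qed

lemma independence_number_ge:
  "finite (pverts G) \<Longrightarrow> independent_set G S \<Longrightarrow> card S \<le> independence_number G"
  unfolding independence_number_def by (rule Max_ge[OF finite_independent_cards]) auto

lemma independence_number_attained:
  assumes "finite (pverts G)"
  obtains S where "independent_set G S" "card S = independence_number G"
proof -
  have "independent_set G {}"
    by (simp add: independent_set_def)
  then have "{card S |S. independent_set G S} \<noteq> {}"
    by blast
  from Max_in[OF finite_independent_cards[OF assms] this]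
  have "independence_number G \<in> {card S |S. independent_set G S}"
    by (simp only: independence_number_def)
  then show thesis
    using that by auto
qed

lemma independence_ratio_le_1:
  assumes "finite (pverts G)"
  shows "independence_ratio G \<le> 1"
proof -
  obtain S where "independent_set G S" "card S = independence_number G"
    using independence_number_attained[OF assms] .
  then have "independence_number G \<le> card (pverts G)"
    using assms by (metis card_mono independent_set_def)
  then show ?thesis
    by (auto simp: independence_ratio_def divide_le_eq_1)
qed

lemma independence_ratio_tensor_power_Suc:
  assumes fin: "finite (pverts G)" and ne: "pverts G \<noteq> {}"
  shows "independence_ratio (tensor_power G k) \<le> independence_ratio (tensor_power G (Suc k))"
proof -
  obtain S where S: "independent_set (tensor_power G k) S"
      "card S = independence_number (tensor_power G k)"
    using independence_number_attained[OF finite_pverts_tensor_power[OF fin]] .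
  let ?T = "(\<lambda>(x, xs). x # xs) ` (pverts G \<times> S)"
  have "independent_set (tensor_power G (Suc k)) ?T"
    using S(1) by (fastforce simp: independent_set_def tensor_power_def)
  then have "card ?T \<le> independence_number (tensor_power G (Suc k))"
    by (intro independence_number_ge finite_pverts_tensor_power fin)
  moreover have "card ?T = card (pverts G) * card S"
    by (subst card_image) (auto simp: inj_on_def card_cartesian_product)
  ultimately have "card (pverts G) * independence_number (tensor_power G k)
      \<le> independence_number (tensor_power G (Suc k))"
    using S(2) by simp
  then have "real (card (pverts G)) * real (independence_number (tensor_power G k))
      \<le> real (independence_number (tensor_power G (Suc k)))"
    by (metis of_nat_le_iff of_nat_mult)
  moreover have "card (pverts G) > 0"
    using fin ne by (simp add: card_gt_0_iff)
  ultimately show ?thesis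
    unfolding independence_ratio_def card_pverts_tensor_power[OF fin]
    by (simp add: field_simps)
qed

lemma tensor_capacity_LIMSEQ:
  assumes "finite (pverts G)" "pverts G \<noteq> {}"
  shows "(\<lambda>k. independence_ratio (tensor_power G k)) \<longlonglongrightarrow> tensor_capacity G"
proof -
  have "incseq (\<lambda>k. independence_ratio (tensor_power G k))"
    using independence_ratio_tensor_power_Suc[OF assms] by (rule incseq_SucI)
  moreover have "\<And>k. independence_ratio (tensor_power G k) \<le> 1"
    using independence_ratio_le_1 finite_pverts_tensor_power assms(1) by blast
  ultimately have "convergent (\<lambda>k. independence_ratio (tensor_power G k))"
    by (meson convergentI incseq_convergent)
  then show ?thesis
    by (simp add: tensor_capacity_def convergent_LIMSEQ_iff)
qed


section \<open>Algorithms and their running time\<close>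

text \<open>
  Algorithms are programs of a random access machine with the logarithmic cost criterion
  (Aho, Hopcroft and Ullman), which is polynomially equivalent to multitape Turing machines.
  The machine has structured control flow, and the memory is divided into unbounded arrays of
  natural numbers named by strings; the names that a program uses are fixed in its text, so there
  are finitely many and they amount to interleaved segments of one memory. Every operation is
  charged the binary length of all the numbers (indices included) that it reads or writes.
\<close>

type_synonym store = "string \<Rightarrow> nat \<Rightarrow> nat"

datatype expr =
    Const nat
  | Cell string expr
  | Add expr expr
  | Sub expr expr
  | Mul expr expr

datatype prog =
    Skip
  | Assign string expr expr
  | Seq prog prog
  | Cond expr prog prog
  | While expr prog

definition bit_length :: "nat \<Rightarrow> nat" where
  "bit_length n = floor_log n + 1"

fun expr_val :: "expr \<Rightarrow> store \<Rightarrow> nat" where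
  "expr_val (Const n) s = n"
| "expr_val (Cell x e) s = s x (expr_val e s)"
| "expr_val (Add e1 e2) s = expr_val e1 s + expr_val e2 s"
| "expr_val (Sub e1 e2) s = expr_val e1 s - expr_val e2 s"
| "expr_val (Mul e1 e2) s = expr_val e1 s * expr_val e2 s"

fun expr_cost :: "expr \<Rightarrow> store \<Rightarrow> nat" where
  "expr_cost (Const n) s = bit_length n"
| "expr_cost (Cell x e) s =
     expr_cost e s + bit_length (expr_val e s) + bit_length (s x (expr_val e s))"
| "expr_cost (Add e1 e2) s =
     expr_cost e1 s + expr_cost e2 s + bit_length (expr_val e1 s) + bit_length (expr_val e2 s)"
| "expr_cost (Sub e1 e2) s =
     expr_cost e1 s + expr_cost e2 s + bit_length (expr_val e1 s) + bit_length (expr_val e2 s)"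
| "expr_cost (Mul e1 e2) s =
     expr_cost e1 s + expr_cost e2 s + bit_length (expr_val e1 s) + bit_length (expr_val e2 s)"

text \<open>
  \<open>exec c s t s'\<close>: started in the store \<open>s\<close>, the program \<open>c\<close> halts after time \<open>t\<close> in the store \<open>s'\<close>.
  The program \<open>Assign x e1 e2\<close> writes the value of \<open>e2\<close> to the cell of the array \<open>x\<close> whose index is
  the value of \<open>e1\<close>. A condition is true iff its value is nonzero.
\<close>

inductive exec :: "prog \<Rightarrow> store \<Rightarrow> nat \<Rightarrow> store \<Rightarrow> bool" where
  Skip: "exec Skip s 1 s"
| Assign: "exec (Assign x e1 e2) s
     (expr_cost e1 s + expr_cost e2 s + bit_length (expr_val e1 s) + bit_length (expr_val e2 s))
     (s(x := (s x)(expr_val e1 s := expr_val e2 s)))"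
| Seq: "exec c1 s t1 s1 \<Longrightarrow> exec c2 s1 t2 s2 \<Longrightarrow> exec (Seq c1 c2) s (t1 + t2) s2"
| Cond_True: "expr_val e s \<noteq> 0 \<Longrightarrow> exec c1 s t s' \<Longrightarrow>
     exec (Cond e c1 c2) s (expr_cost e s + bit_length (expr_val e s) + t) s'"
| Cond_False: "expr_val e s = 0 \<Longrightarrow> exec c2 s t s' \<Longrightarrow>
     exec (Cond e c1 c2) s (expr_cost e s + bit_length (expr_val e s) + t) s'"
| While_True: "expr_val e s \<noteq> 0 \<Longrightarrow> exec c s t1 s1 \<Longrightarrow> exec (While e c) s1 t2 s2 \<Longrightarrow>
     exec (While e c) s (expr_cost e s + bit_length (expr_val e s) + t1 + t2) s2"
| While_False: "expr_val e s = 0 \<Longrightarrow>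
     exec (While e c) s (expr_cost e s + bit_length (expr_val e s)) s"

inductive_cases exec_SkipE: "exec Skip s t s'"
  and exec_AssignE: "exec (Assign x e1 e2) s t s'"
  and exec_SeqE: "exec (Seq c1 c2) s t s'"
  and exec_CondE: "exec (Cond e c1 c2) s t s'"
  and exec_WhileE: "exec (While e c) s t s'"

lemma exec_deterministic:
  "exec c s t s' \<Longrightarrow> exec c s u s'' \<Longrightarrow> t = u \<and> s' = s''"
proof (induction arbitrary: u s'' rule: exec.induct)
  case Skip
  then show ?case by (auto elim: exec_SkipE)
next
  case Assign
  then show ?case by (auto elim: exec_AssignE)
next
  case (Seq c1 s t1 s1 c2 t2 s2)
  from Seq.prems obtain u1 r u2
    where u: "u = u1 + u2" and 1: "exec c1 s u1 r" and 2: "exec c2 r u2 s''"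
    by (rule exec_SeqE)
  from Seq.IH(1)[OF 1] have "t1 = u1" "s1 = r" by simp_all
  with Seq.IH(2)[of u2 s''] 2 u show ?case by simp
next
  case (Cond_True e s c1 t s' c2)
  from Cond_True.prems Cond_True.hyps obtain v
    where "u = expr_cost e s + bit_length (expr_val e s) + v" and 1: "exec c1 s v s''"
    by (auto elim: exec_CondE)
  with Cond_True.IH[OF 1] show ?case by simp
next
  case (Cond_False e s c2 t s' c1)
  from Cond_False.prems Cond_False.hyps obtain v
    where "u = expr_cost e s + bit_length (expr_val e s) + v" and 1: "exec c2 s v s''"
    by (auto elim: exec_CondE)
  with Cond_False.IH[OF 1] show ?case by simp
next
  case (While_True e s c t1 s1 t2 s2)
  from While_True.prems While_True.hyps obtain u1 r u2
    where u: "u = expr_cost e s + bit_length (expr_val e s) + u1 + u2"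
      and 1: "exec c s u1 r" and 2: "exec (While e c) r u2 s''"
    by (auto elim: exec_WhileE)
  from While_True.IH(1)[OF 1] have "t1 = u1" "s1 = r" by simp_all
  with While_True.IH(2)[of u2 s''] 2 u show ?case by simp
next
  case (While_False e s c)
  from While_False.prems While_False.hyps show ?case by (auto elim: exec_WhileE)
qed

text \<open>
  The input is a graph with vertex set \<open>{..<n}\<close>, given by \<open>n\<close> and its adjacency matrix in
  row-major order; all other cells are initially zero. The output is a rational number, given by
  its numerator and its (nonzero) denominator.
\<close>

definition graph_input :: "nat \<Rightarrow> nat pair_pre_digraph \<Rightarrow> store" where
  "graph_input n G = (\<lambda>_ _. 0)
     (''n'' := (\<lambda>_. 0)(0 := n),
      ''adj'' := (\<lambda>i. if i < n * n \<and> (i div n, i mod n) \<in> parcs G then 1 else 0))"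

definition outputs_rational :: "store \<Rightarrow> real \<Rightarrow> bool" where
  "outputs_rational s r \<longleftrightarrow>
     s ''den'' 0 \<noteq> 0 \<and> r = real (s ''num'' 0) / real (s ''den'' 0)"

end

theory Submission
  imports Defs
begin

text \<open>
  Let \<open>c\<close> be the minimum of \<open>|N(I)| / |I|\<close> over the nonempty independent sets \<open>I\<close> of \<open>G\<close>. By a theorem of
  Toth, the tensor capacity is \<open>1 / (1 + c)\<close> if \<open>c \<ge> 1\<close> and \<open>1\<close> otherwise: for \<open>c \<ge> 1\<close>, the
  bound \<open>|N(I)| \<ge> c |I|\<close> passes from the factors to a tensor product, and it limits the independence
  ratio. For fixed \<open>p\<close> and \<open>q\<close>, the maximum of \<open>p |I| - q |N(I)|\<close> on a cograph satisfies a
  simple recursion over disjoint unions and joins, which are found by repeatedly merging a pair of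
  twin vertices; this maximum is \<open>0\<close> iff \<open>p / q \<le> c\<close>. Since \<open>c\<close> is a quotient of numbers up to \<open>n\<close>,
  testing all \<open>p, q \<le> n\<close> determines the capacity.
\<close>

section \<open>Neighbourhood expansion in tensor powers\<close>

text \<open>The rows and columns of an independent set of a product need not be independent, so a
  bound for independent sets alone cannot be iterated. What passes to products is the weighted bound
  for arbitrary sets in \<open>expanding_isolated_part\<close>. It needs c \<ge> 1, hence only pairs
  with \<open>q \<le> p\<close> are accepted; below this threshold the capacity jumps from at most
  1/2 to 1, by an unrelated weighting argument. The quotient |N(I)| / |I| does not decompose over
  disjoint unions and joins, whereas the linear expression p |I| - q |N(I)| does; this is why
  thresholds p/q are tested instead of computing c by a recursion. The empty set has gain 0, so the
  maximal gain is a natural number and truncated subtraction suffices throughout. Fractions are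
  compared by cross multiplication, so the program uses natural numbers only.\<close>

definition nbrs :: "'a pair_pre_digraph \<Rightarrow> 'a set \<Rightarrow> 'a set" where
  "nbrs G S = {y \<in> pverts G. \<exists>x\<in>S. (x, y) \<in> parcs G}"

text \<open>For \<open>q > 0\<close> this says p/q \<le> c. With denominators cleared, the empty set
  satisfies it trivially.\<close>

definition expanding :: "nat \<Rightarrow> nat \<Rightarrow> 'a pair_pre_digraph \<Rightarrow> bool" where
  "expanding p q G \<longleftrightarrow> (\<forall>I. independent_set G I \<longrightarrow> p * card I \<le> q * card (nbrs G I))"

lemma nbrs_subset: "nbrs G S \<subseteq> pverts G"
  by (auto simp: nbrs_def)

lemma finite_nbrs: "finite (pverts G) \<Longrightarrow> finite (nbrs G S)"
  by (rule finite_subset[OF nbrs_subset])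

lemma independent_set_disjoint_nbrs: "independent_set G I \<Longrightarrow> I \<inter> nbrs G I = {}"
  by (auto simp: independent_set_def nbrs_def)

lemma finite_independent_set: "finite (pverts G) \<Longrightarrow> independent_set G I \<Longrightarrow> finite I"
  unfolding independent_set_def by (metis finite_subset)

lemma card_independent_set_plus_nbrs_le:
  assumes "finite (pverts G)" "independent_set G I"
  shows "card I + card (nbrs G I) \<le> card (pverts G)"
proof -
  have "I \<union> nbrs G I \<subseteq> pverts G"
    using assms by (auto simp: independent_set_def nbrs_def)
  then show ?thesis
    using independent_set_disjoint_nbrs[OF assms(2)] finite_nbrs[OF assms(1)]
      finite_independent_set[OF assms] assms(1)
    by (metis card_Un_disjoint card_mono)
qed

text \<open>The points \<open>I\<close> of \<open>S\<close> without a neighbour in \<open>S\<close>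
  are independent; by symmetry \<open>nbrs G I\<close> misses \<open>S\<close>, while all of
  \<open>S - I\<close> lies in \<open>nbrs G S\<close>. So \<open>nbrs G S\<close> contains two
  disjoint parts, which account for p |I| and q |S - I|. Passing from \<open>I\<close> to
  \<open>B\<close> lowers the weight of \<open>I - B\<close> from \<open>p\<close> to
  \<open>q\<close>, which is where \<open>q \<le> p\<close> enters.\<close>

lemma expanding_isolated_part:
  assumes exp: "expanding p q G" and "q \<le> p" and fin: "finite (pverts G)"
    and sym: "sym (parcs G)" and S: "S \<subseteq> pverts G" and B: "B \<subseteq> S" "B \<inter> nbrs G S = {}"
  shows "p * card B + q * card (S - B) \<le> q * card (nbrs G S)"
proof -
  define I where "I = S - nbrs G S"
  have finS: "finite S" using S fin finite_subset by blast
  have "independent_set G I"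
    using S by (auto simp: independent_set_def I_def nbrs_def)
  then have I: "p * card I \<le> q * card (nbrs G I)"
    using exp by (simp add: expanding_def)
  have "nbrs G I \<inter> S = {}"
    using sym S by (auto simp: I_def nbrs_def dest: symD)
  moreover have "nbrs G I \<union> (S - I) \<subseteq> nbrs G S"
    by (auto simp: I_def nbrs_def)
  ultimately have "card (nbrs G I) + card (S - I) \<le> card (nbrs G S)"
    using finite_nbrs[OF fin] finS
    by (subst card_Un_disjoint[symmetric]) (auto intro: card_mono)
  then have "q * card (nbrs G I) + q * card (S - I) \<le> q * card (nbrs G S)"
    by (metis add_mult_distrib2 mult_le_mono2)
  moreover have "B \<subseteq> I" using B by (auto simp: I_def)
  then have "card I = card B + card (I - B)" "card (S - B) = card (S - I) + card (I - B)"
  proof -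
    have finI: "finite I" using finS I_def by simp
    show "card I = card B + card (I - B)"
      using \<open>B \<subseteq> I\<close> finI by (metis card_Diff_subset card_mono finite_subset le_add_diff_inverse)
    have "S - B = (S - I) \<union> (I - B)" using \<open>B \<subseteq> I\<close> by (auto simp: I_def)
    then show "card (S - B) = card (S - I) + card (I - B)"
      using finS finI by (simp only:) (intro card_Un_disjoint, auto)
  qed
  moreover have "q * card (I - B) \<le> p * card (I - B)"
    using \<open>q \<le> p\<close> by (rule mult_le_mono1)
  moreover have "p * card I = p * card B + p * card (I - B)"
      "q * card (S - B) = q * card (S - I) + q * card (I - B)"
    using calculation(2,3) by (simp_all add: add_mult_distrib2)
  ultimately show ?thesis
    using I by linarith
qed

lemma card_rows:
  assumes "finite X" "finite Y" "S \<subseteq> X \<times> Y"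
  shows "card S = (\<Sum>x\<in>X. card {y. (x, y) \<in> S})"
proof -
  have "S = (SIGMA x:X. {y. (x, y) \<in> S})"
    using assms by auto
  moreover have "finite {y. (x, y) \<in> S}" for x
    by (rule finite_subset[OF _ assms(2)]) (use assms in auto)
  ultimately show ?thesis
    using card_SigmaI[OF assms(1), of "\<lambda>x. {y. (x, y) \<in> S}"] by simp
qed

lemma card_columns:
  assumes "finite X" "finite Y" "S \<subseteq> X \<times> Y"
  shows "card S = (\<Sum>y\<in>Y. card {x. (x, y) \<in> S})"
proof -
  have "card (prod.swap ` S) = (\<Sum>y\<in>Y. card {x. (y, x) \<in> prod.swap ` S})"
    using assms by (intro card_rows) auto
  moreover have "{x. (y, x) \<in> prod.swap ` S} = {x. (x, y) \<in> S}" for y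
    by force
  ultimately show ?thesis
    by (simp add: card_image)
qed

text \<open>
  An independent set \<open>U\<close> of the product splits into the points \<open>A\<close> without and the points \<open>B\<close> with a
  neighbour in their own column. The column neighbours \<open>M\<close> of \<open>A\<close> number at least \<open>p/q |A|\<close>; in
  every row of \<open>M \<union> B\<close> the points of \<open>B\<close> are isolated, and all row neighbours of \<open>M \<union> B\<close> are
  neighbours of \<open>U\<close>.
\<close>

lemma expanding_tensor_product:
  assumes G: "expanding p q G" "finite (pverts G)" "sym (parcs G)"
    and H: "expanding p q H" "finite (pverts H)" "sym (parcs H)" and "q \<le> p"
  shows "expanding p q (tensor_product G H)"
  unfolding expanding_def
proof (intro allI impI)
  fix U assume U: "independent_set (tensor_product G H) U"
  let ?V = "pverts G" and ?W = "pverts H"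
  have UV: "U \<subseteq> ?V \<times> ?W"
    using U by (simp add: independent_set_def tensor_product_def)
  have nadj: "(h, h') \<notin> parcs H" if "(g, h) \<in> U" "(g', h') \<in> U" "(g, g') \<in> parcs G" for g h g' h'
    using U that by (force simp: independent_set_def tensor_product_def)
  define B where "B = {(g, h). (g, h) \<in> U \<and> (\<exists>g'. (g', h) \<in> U \<and> (g', g) \<in> parcs G)}"
  define A where "A = U - B"
  define M where "M = {(g, h). h \<in> ?W \<and> g \<in> nbrs G {x. (x, h) \<in> A}}"
  let ?N = "nbrs (tensor_product G H) U"
  have sub: "A \<subseteq> ?V \<times> ?W" "B \<subseteq> ?V \<times> ?W" "M \<subseteq> ?V \<times> ?W" "?N \<subseteq> ?V \<times> ?W"
    using UV by (auto simp: A_def B_def M_def nbrs_def tensor_product_def)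
  have "p * card A \<le> q * card M"
  proof -
    have "p * card {x. (x, h) \<in> A} \<le> q * card {x. (x, h) \<in> M}" if "h \<in> ?W" for h
    proof -
      have "independent_set G {x. (x, h) \<in> A}"
        using UV by (auto simp: independent_set_def A_def B_def)
      moreover have "{x. (x, h) \<in> M} = nbrs G {x. (x, h) \<in> A}"
        using that by (auto simp: M_def)
      ultimately show ?thesis
        using G(1) by (simp add: expanding_def)
    qed
    then show ?thesis
      unfolding card_columns[OF G(2) H(2) sub(1)] card_columns[OF G(2) H(2) sub(3)]
        sum_distrib_left by (rule sum_mono)
  qed
  moreover have "p * card B + q * card M \<le> q * card ?N"
  proof -
    have row: "p * card {h. (g, h) \<in> B} + q * card {h. (g, h) \<in> M} \<le> q * card {h. (g, h) \<in> ?N}"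
      if g: "g \<in> ?V" for g
    proof -
      let ?B = "{h. (g, h) \<in> B}" and ?M = "{h. (g, h) \<in> M}"
      \<comment> \<open>A common point would lie in \<open>U\<close> and be adjacent, in its column,
        to a point of \<open>A\<close>; by symmetry that point would belong to
        \<open>B\<close>.\<close>
      have MU: "?M \<inter> ?B = {}"
        using G(3) by (auto simp: M_def A_def B_def nbrs_def dest: symD)
      \<comment> \<open>Each h in \<open>?M \<union> ?B\<close> comes with a point (g0, h) of
        \<open>U\<close> and an arc from g0 to g. A neighbour h' of h thus makes (g, h') a neighbour
        of \<open>U\<close> in the product: it is in \<open>?N\<close> and cannot be in
        \<open>U\<close>.\<close>
      have "(h, h') \<notin> parcs H" if h: "h \<in> ?M \<union> ?B" and h': "(g, h') \<in> B" for h h'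
      proof -
        obtain g0 where "(g0, h) \<in> U" "(g0, g) \<in> parcs G"
          using h unfolding M_def A_def B_def nbrs_def by blast
        moreover have "(g, h') \<in> U" using h' by (auto simp: B_def)
        ultimately show ?thesis using nadj by blast
      qed
      then have iso: "?B \<inter> nbrs H (?M \<union> ?B) = {}"
        by (auto simp: nbrs_def)
      have "nbrs H (?M \<union> ?B) \<subseteq> {h. (g, h) \<in> ?N}"
        using g by (fastforce simp: nbrs_def tensor_product_def M_def A_def B_def)
      moreover have "finite {h. (g, h) \<in> ?N}"
        by (rule finite_subset[OF _ H(2)]) (use sub(4) in auto)
      ultimately have N: "q * card (nbrs H (?M \<union> ?B)) \<le> q * card {h. (g, h) \<in> ?N}"
        by (simp add: card_mono)
      have "p * card ?B + q * card (?M \<union> ?B - ?B) \<le> q * card (nbrs H (?M \<union> ?B))"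
        by (rule expanding_isolated_part[OF H(1) \<open>q \<le> p\<close> H(2,3)]) (use sub iso in auto)
      moreover have "?M \<union> ?B - ?B = ?M" using MU by auto
      ultimately have "p * card ?B + q * card ?M \<le> q * card (nbrs H (?M \<union> ?B))"
        by simp
      also note N
      finally show ?thesis .
    qed
    have "p * card B + q * card M =
        (\<Sum>g\<in>?V. p * card {h. (g, h) \<in> B} + q * card {h. (g, h) \<in> M})"
      unfolding card_rows[OF G(2) H(2) sub(2)] card_rows[OF G(2) H(2) sub(3)]
      by (simp add: sum_distrib_left sum.distrib)
    also have "\<dots> \<le> (\<Sum>g\<in>?V. q * card {h. (g, h) \<in> ?N})"
      using row by (rule sum_mono)
    also have "\<dots> = q * card ?N"
      unfolding card_rows[OF G(2) H(2) sub(4)] by (simp add: sum_distrib_left)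
    finally show ?thesis .
  qed
  moreover have "card U = card A + card B"
  proof -
    have "B \<subseteq> U" "finite U"
      using UV G(2) H(2) by (auto simp: B_def intro: finite_subset[of _ "?V \<times> ?W"])
    then show ?thesis
      unfolding A_def by (metis add.commute card_Diff_subset card_mono finite_subset le_add_diff_inverse)
  qed
  ultimately show "p * card U \<le> q * card ?N"
    by (simp add: add_mult_distrib2)
qed

lemma sym_tensor_power: "sym (parcs G) \<Longrightarrow> sym (parcs (tensor_power G k))"
  unfolding sym_def tensor_power_def list_all2_conv_all_nth by simp

lemma expanding_tensor_power:
  assumes "expanding p q G" "finite (pverts G)" "sym (parcs G)" "q \<le> p"
  shows "expanding p q (tensor_power G k)"
proof (induction k)
  case 0
  \<comment> \<open>The only vertex is the empty list, and it carries a loop.\<close>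
  have "I = {}" if "independent_set (tensor_power G 0) I" for I
    using that by (auto simp: independent_set_def tensor_power_def)
  then show ?case unfolding expanding_def by fastforce
next
  case (Suc k)
  let ?P = "tensor_product G (tensor_power G k)" and ?c = "\<lambda>(x, xs). x # xs"
  have inj: "inj ?c" by (auto simp: inj_def)
  have P: "expanding p q ?P"
    using assms Suc by (intro expanding_tensor_product finite_pverts_tensor_power sym_tensor_power)
  show ?case
    unfolding expanding_def
  proof (intro allI impI)
    fix I assume I: "independent_set (tensor_power G (Suc k)) I"
    then obtain J where J: "J \<subseteq> pverts ?P" "I = ?c ` J"
      unfolding independent_set_def pverts_tensor_power_Suc by (auto elim: subset_imageE)
    have arc: "(?c a, ?c b) \<in> parcs (tensor_power G (Suc k)) \<longleftrightarrow> (a, b) \<in> parcs ?P" for a b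
      unfolding parcs_tensor_power_Suc by (force split: prod.splits)
    have "independent_set ?P J"
      using I J arc by (auto simp: independent_set_def)
    then have "p * card J \<le> q * card (nbrs ?P J)"
      using P by (simp add: expanding_def)
    moreover have "nbrs (tensor_power G (Suc k)) I = ?c ` nbrs ?P J"
    proof -
      have "(\<exists>x\<in>I. (x, ?c y) \<in> parcs (tensor_power G (Suc k))) \<longleftrightarrow> (\<exists>x\<in>J. (x, y) \<in> parcs ?P)" for y
        unfolding J(2) by (simp only: bex_simps arc)
      then show ?thesis
        unfolding nbrs_def pverts_tensor_power_Suc by blast
    qed
    moreover have "card (?c ` J) = card J" "card (?c ` nbrs ?P J) = card (nbrs ?P J)"
      using inj by (auto intro!: card_image simp: inj_on_def)
    ultimately show "p * card I \<le> q * card (nbrs (tensor_power G (Suc k)) I)"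
      using J by simp
  qed
qed

text \<open>\<open>I\<close> and its neighbourhood are disjoint, so q |V| \<ge> q |I| + q |N(I)|
  \<ge> (p + q) |I| for a maximum independent set \<open>I\<close>.\<close>

lemma independence_ratio_le_if_expanding:
  assumes "expanding p q G" "finite (pverts G)" "0 < q"
  shows "independence_ratio G \<le> real q / real (p + q)"
proof -
  obtain I where I: "independent_set G I" "card I = independence_number G"
    using independence_number_attained[OF assms(2)] .
  have "card I + card (nbrs G I) \<le> card (pverts G)"
    using card_independent_set_plus_nbrs_le[OF assms(2) I(1)] .
  then have "q * card I + q * card (nbrs G I) \<le> q * card (pverts G)"
    by (metis add_mult_distrib2 mult_le_mono2)
  moreover have "p * card I \<le> q * card (nbrs G I)"
    using assms(1) I(1) by (simp add: expanding_def)
  ultimately have "(p + q) * card I \<le> q * card (pverts G)"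
    by (simp add: algebra_simps)
  then have "real (p + q) * real (independence_number G) \<le> real q * real (card (pverts G))"
    unfolding I(2) by (metis of_nat_le_iff of_nat_mult)
  then show ?thesis
    using assms(3) unfolding independence_ratio_def
    by (cases "card (pverts G) = 0") (auto simp: field_simps)
qed

lemma tensor_capacity_le_if_expanding:
  assumes "expanding p q G" "finite (pverts G)" "pverts G \<noteq> {}" "sym (parcs G)" "q \<le> p" "0 < q"
  shows "tensor_capacity G \<le> real q / real (p + q)"
proof (rule LIMSEQ_le_const2[OF tensor_capacity_LIMSEQ[OF assms(2,3)]], intro exI allI impI)
  show "independence_ratio (tensor_power G k) \<le> real q / real (p + q)" for k
    using assms by (intro independence_ratio_le_if_expanding expanding_tensor_power
        finite_pverts_tensor_power)
qed

section \<open>Lower bounds for the tensor capacity\<close>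

lemma tensor_capacity_le_1:
  assumes "finite (pverts G)" "pverts G \<noteq> {}"
  shows "tensor_capacity G \<le> 1"
proof (rule LIMSEQ_le_const2[OF tensor_capacity_LIMSEQ[OF assms]], intro exI allI impI)
  show "independence_ratio (tensor_power G k) \<le> 1" for k
    using assms by (intro independence_ratio_le_1 finite_pverts_tensor_power)
qed

text \<open>Take the lists with head in \<open>I\<close> and any tail, and those with head outside
  \<open>I\<close> and \<open>nbrs G I\<close> and tail in a maximum independent set of the lower
  power. Heads in \<open>I\<close> have all their neighbours in \<open>nbrs G I\<close>, which is
  avoided; two heads of the second kind are separated by their tails.\<close>

lemma independence_number_tensor_power_Suc_ge:
  assumes fin: "finite (pverts G)" and sym: "sym (parcs G)" and I: "independent_set G I"
  shows "card I * card (pverts G) ^ k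
      + (card (pverts G) - card I - card (nbrs G I)) * independence_number (tensor_power G k)
      \<le> independence_number (tensor_power G (Suc k))"
proof -
  let ?V = "pverts G" and ?N = "nbrs G I" and ?P = "tensor_power G k" and ?c = "\<lambda>(x, xs). x # xs"
  obtain S where S: "independent_set ?P S" "card S = independence_number ?P"
    using independence_number_attained[OF finite_pverts_tensor_power[OF fin]] .
  let ?T = "I \<times> pverts ?P \<union> (?V - I - ?N) \<times> S"
  have arcs: "(x # xs, y # ys) \<in> parcs (tensor_power G (Suc k)) \<longleftrightarrow>
      (x, y) \<in> parcs G \<and> (xs, ys) \<in> parcs ?P" for x xs y ys
    by (auto simp: tensor_power_def)
  have IV: "I \<subseteq> ?V" and SV: "S \<subseteq> pverts ?P"
    using I S by (auto simp: independent_set_def)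
  have "?T \<subseteq> pverts G \<times> pverts ?P"
    using IV SV by auto
  then have "?c ` ?T \<subseteq> pverts (tensor_power G (Suc k))"
    unfolding pverts_tensor_power_Suc tensor_product_def by auto
  moreover have "(?c a, ?c b) \<notin> parcs (tensor_power G (Suc k))" if "a \<in> ?T" "b \<in> ?T" for a b
    using that I S(1) IV sym
    by (auto simp: arcs independent_set_def nbrs_def dest: symD)
  ultimately have "independent_set (tensor_power G (Suc k)) (?c ` ?T)"
    by (auto simp: independent_set_def)
  then have "card (?c ` ?T) \<le> independence_number (tensor_power G (Suc k))"
    by (intro independence_number_ge finite_pverts_tensor_power fin)
  moreover have "card (?c ` ?T) = card ?T"
    by (rule card_image) (auto simp: inj_on_def)
  moreover have "card ?T = card (I \<times> pverts ?P) + card ((?V - I - ?N) \<times> S)"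
    using fin finite_pverts_tensor_power[OF fin] finite_independent_set[OF fin I] SV
    by (intro card_Un_disjoint) (auto intro: finite_subset)
  moreover have "card (?V - I - ?N) = card ?V - card I - card ?N"
  proof -
    have "card (?V - I - ?N) = card (?V - I) - card ?N"
      using independent_set_disjoint_nbrs[OF I] nbrs_subset[of G I] finite_nbrs[OF fin]
      by (intro card_Diff_subset) auto
    then show ?thesis
      using IV finite_independent_set[OF fin I] by (simp add: card_Diff_subset)
  qed
  ultimately show ?thesis
    by (simp add: card_cartesian_product S(2) card_pverts_tensor_power[OF fin])
qed

text \<open>Divided by n^k, the preceding recurrence relates consecutive ratios affinely. In the
  limit it reads n \<Theta> \<ge> i + (n - i - m) \<Theta>, which gives \<Theta> \<ge> i / (i +
  m).\<close>

lemma tensor_capacity_ge: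
  assumes fin: "finite (pverts G)" and sym: "sym (parcs G)" and I: "independent_set G I" "I \<noteq> {}"
  shows "real (card I) / real (card I + card (nbrs G I)) \<le> tensor_capacity G"
proof -
  let ?n = "card (pverts G)" and ?r = "\<lambda>k. independence_ratio (tensor_power G k)"
  let ?i = "card I" and ?m = "card (nbrs G I)"
  have ne: "pverts G \<noteq> {}" using I by (auto simp: independent_set_def)
  then have n: "?n > 0" using fin by (simp add: card_gt_0_iff)
  have im: "?i + ?m \<le> ?n" using card_independent_set_plus_nbrs_le[OF fin I(1)] .
  have step: "real ?i + (real ?n - real ?i - real ?m) * ?r k \<le> real ?n * ?r (Suc k)" for k
  proof -
    have "real (?i * ?n ^ k + (?n - ?i - ?m) * independence_number (tensor_power G k))
        \<le> real (independence_number (tensor_power G (Suc k)))"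
      using independence_number_tensor_power_Suc_ge[OF fin sym I(1), of k] by (simp only: of_nat_le_iff)
    then have "real ?i * real ?n ^ k
        + (real ?n - real ?i - real ?m) * real (independence_number (tensor_power G k))
        \<le> real (independence_number (tensor_power G (Suc k)))"
      using im by (simp add: of_nat_diff diff_diff_eq)
    from divide_right_mono[OF this, of "real ?n ^ k"] show ?thesis
      using n unfolding independence_ratio_def card_pverts_tensor_power[OF fin]
      by (simp add: add_divide_distrib)
  qed
  have lim: "?r \<longlonglongrightarrow> tensor_capacity G"
    using tensor_capacity_LIMSEQ[OF fin ne] .
  have "real ?i + (real ?n - real ?i - real ?m) * tensor_capacity G \<le> real ?n * tensor_capacity G"
    by (rule LIMSEQ_le[where X = "\<lambda>k. real ?i + (real ?n - real ?i - real ?m) * ?r k"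
          and Y = "\<lambda>k. real ?n * ?r (Suc k)"])
      (use step lim in \<open>auto intro!: tendsto_intros LIMSEQ_Suc\<close>)
  then have "real ?i \<le> tensor_capacity G * real (?i + ?m)"
    by (simp add: algebra_simps)
  moreover have "?i > 0"
    using I finite_independent_set[OF fin I(1)] by (simp add: card_gt_0_iff)
  ultimately show ?thesis
    by (simp add: divide_le_eq)
qed

text \<open>Expanding the power of the sum gives one product per list. This is the total weight
  needed for the Markov estimate below.\<close>

lemma sum_prod_list_tensor_power:
  fixes f :: "'a \<Rightarrow> real"
  assumes "finite (pverts G)"
  shows "(\<Sum>xs\<in>pverts (tensor_power G k). prod_list (map f xs)) = (\<Sum>x\<in>pverts G. f x) ^ k"
proof (induction k)
  case 0
  have "pverts (tensor_power G 0) = {[]}" by (auto simp: tensor_power_def)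
  then show ?case by simp
next
  case (Suc k)
  have "inj_on (\<lambda>(x, xs). x # xs) X" for X :: "('a \<times> 'a list) set"
    by (auto simp: inj_on_def)
  then show ?case
    unfolding pverts_tensor_power_Suc
    by (simp add: sum.reindex tensor_product_def case_prod_unfold Suc[symmetric] sum_product
        sum.cartesian_product)
qed

text \<open>
  Weighting \<open>I\<close> by a suitable \<open>t < 1\<close> and its neighbours by \<open>1/t\<close> makes the average weight less
  than \<open>1\<close>, so that almost all vertices of a high power have weight below \<open>1\<close>. The
  weights of adjacent vertices multiply to at least \<open>1\<close>, hence these vertices are independent.
\<close>

lemma tensor_capacity_eq_1:
  assumes fin: "finite (pverts G)" and sym: "sym (parcs G)" and arcs: "parcs G \<subseteq> pverts G \<times> pverts G"
    and I: "independent_set G I" and less: "card (nbrs G I) < card I"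
  shows "tensor_capacity G = 1"
proof -
  let ?V = "pverts G" and ?N = "nbrs G I"
  define a b where "a = real (card I)" and "b = real (card ?N)"
  define n where "n = real (card ?V)"
  have ab: "0 \<le> b" "b < a" using less by (auto simp: a_def b_def)
  \<comment> \<open>The midpoint of b/a and 1. For t > 0, the condition a t + b/t < a + b amounts to
    (a t - b)(t - 1) < 0, that is b/a < t < 1.\<close>
  define t where "t = (a + b) / (2 * a)"
  have t: "0 < t" "t < 1" using ab by (auto simp: t_def field_simps)
  define f where "f = (\<lambda>x. if x \<in> I then t else if x \<in> ?N then 1 / t else 1)"
  have fpos: "0 < f x" for x using t by (simp add: f_def)
  have ne: "?V \<noteq> {}" using I less by (auto simp: independent_set_def)
  then have n: "n > 0" using fin by (simp add: n_def card_gt_0_iff)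
  have IV: "I \<subseteq> ?V" using I by (simp add: independent_set_def)
  have "(\<Sum>x\<in>?V. f x) = n - a - b + (a * t + b / t)"
  proof -
    have "?V = (?V - I - ?N) \<union> (I \<union> ?N)" using IV nbrs_subset[of G I] by auto
    then have "(\<Sum>x\<in>?V. f x) = (\<Sum>x\<in>(?V - I - ?N) \<union> (I \<union> ?N). f x)" by simp
    also have "\<dots> = (\<Sum>x\<in>?V - I - ?N. f x) + ((\<Sum>x\<in>I. f x) + (\<Sum>x\<in>?N. f x))"
      using fin finite_nbrs[OF fin] finite_independent_set[OF fin I]
        independent_set_disjoint_nbrs[OF I]
      by (subst sum.union_disjoint, auto)+
    also have "(\<Sum>x\<in>?V - I - ?N. f x) = (\<Sum>x\<in>?V - I - ?N. 1)"
      by (rule sum.cong) (auto simp: f_def)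
    also have "\<dots> = n - a - b"
    proof -
      have "?V - I - ?N = ?V - (I \<union> ?N)" by auto
      then have "card (?V - I - ?N) = card ?V - (card I + card ?N)"
        using IV nbrs_subset[of G I] finite_nbrs[OF fin] finite_independent_set[OF fin I]
          independent_set_disjoint_nbrs[OF I]
        by (simp add: card_Diff_subset card_Un_disjoint)
      then show ?thesis
        using card_independent_set_plus_nbrs_le[OF fin I] by (simp add: a_def b_def n_def of_nat_diff)
    qed
    also have "(\<Sum>x\<in>I. f x) = a * t" by (simp add: f_def a_def)
    also have "(\<Sum>x\<in>?N. f x) = (\<Sum>x\<in>?N. 1 / t)"
      using independent_set_disjoint_nbrs[OF I] by (intro sum.cong) (auto simp: f_def)
    also have "\<dots> = b / t" by (simp add: b_def)
    finally show ?thesis by simp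
  qed
  moreover have "a * t + b / t < a + b"
  proof -
    have "(a * t - b) * (t - 1) < 0"
      using ab t by (intro mult_pos_neg) (auto simp: t_def field_simps)
    then have "(a * t + b / t) * t < (a + b) * t"
      using t by (simp add: distrib_right) (simp add: algebra_simps)
    then show ?thesis using t by simp
  qed
  ultimately have sum_less: "(\<Sum>x\<in>?V. f x) < n" by simp
  define \<rho> where "\<rho> = (\<Sum>x\<in>?V. f x) / n"
  have "0 \<le> (\<Sum>x\<in>?V. f x)" using fpos by (intro sum_nonneg) (auto intro: less_imp_le)
  then have \<rho>: "0 \<le> \<rho>" "\<rho> < 1" using n sum_less by (auto simp: \<rho>_def)
  \<comment> \<open>A neighbour of a point of \<open>I\<close> lies in \<open>?N\<close>, and t
    (1/t) = 1; outside \<open>I\<close> all weights are at least 1.\<close>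
  have adj: "1 \<le> f x * f y" if "(x, y) \<in> parcs G" for x y
  proof -
    have "x \<in> ?V" "y \<in> ?V" "(y, x) \<in> parcs G" using that arcs sym by (auto dest: symD)
    then have "x \<in> I \<Longrightarrow> y \<in> ?N - I" "y \<in> I \<Longrightarrow> x \<in> ?N - I"
      using that I by (auto simp: nbrs_def independent_set_def)
    moreover have "x \<notin> I \<Longrightarrow> 1 \<le> f x" "y \<notin> I \<Longrightarrow> 1 \<le> f y"
      using t by (auto simp: f_def)
    then have "x \<notin> I \<Longrightarrow> y \<notin> I \<Longrightarrow> 1 * 1 \<le> f x * f y"
      by (intro mult_mono) auto
    ultimately show ?thesis using t by (cases "x \<in> I"; cases "y \<in> I") (auto simp: f_def)
  qed
  let ?w = "\<lambda>xs. prod_list (map f xs)"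
  have wpos: "0 < ?w xs" for xs by (induction xs) (auto simp: fpos)
  have wadj: "1 \<le> ?w xs * ?w ys" if "list_all2 (\<lambda>u v. (u, v) \<in> parcs G) xs ys" for xs ys
    using that
  proof (induction rule: list_all2_induct)
    case (Cons x xs y ys)
    have "1 * 1 \<le> (f x * f y) * (?w xs * ?w ys)"
      using Cons adj[of x y] by (intro mult_mono) auto
    then show ?case by (simp add: ac_simps)
  qed simp
  have ratio: "1 - \<rho> ^ k \<le> independence_ratio (tensor_power G k)" for k
  proof -
    let ?P = "pverts (tensor_power G k)"
    have finP: "finite ?P" using finite_pverts_tensor_power[OF fin] .
    define T where "T = {xs \<in> ?P. ?w xs < 1}"
    have "independent_set (tensor_power G k) T"
      unfolding independent_set_def
    proof (intro conjI ballI notI)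
      fix xs ys assume T: "xs \<in> T" "ys \<in> T" and "(xs, ys) \<in> parcs (tensor_power G k)"
      then have "1 \<le> ?w xs * ?w ys" using wadj by (auto simp: tensor_power_def)
      moreover have "?w xs * ?w ys < 1 * 1"
        using T wpos by (intro mult_strict_mono) (auto simp: T_def less_imp_le)
      ultimately show False by simp
    qed (auto simp: T_def)
    then have T: "card T \<le> independence_number (tensor_power G k)"
      by (rule independence_number_ge[OF finP])
    \<comment> \<open>Markov's inequality: lists outside \<open>T\<close> weigh at least 1, and the
      total weight is \<rho>^k n^k.\<close>
    have "real (card (?P - T)) = (\<Sum>xs\<in>?P - T. 1)" by simp
    also have "\<dots> \<le> (\<Sum>xs\<in>?P - T. ?w xs)" by (rule sum_mono) (auto simp: T_def)
    also have "\<dots> \<le> (\<Sum>xs\<in>?P. ?w xs)"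
      using wpos finP by (intro sum_mono2) (auto intro: less_imp_le)
    also have "\<dots> = \<rho> ^ k * n ^ k"
      using n by (simp add: sum_prod_list_tensor_power[OF fin] \<rho>_def power_divide)
    finally have "real (card (?P - T)) \<le> \<rho> ^ k * n ^ k" .
    moreover have "card (?P - T) = card ?P - card T" "card T \<le> card ?P"
      using finP by (auto simp: T_def card_Diff_subset intro: card_mono)
    moreover have "real (card ?P) = n ^ k"
      by (simp add: card_pverts_tensor_power[OF fin] n_def)
    ultimately have "n ^ k - real (card T) \<le> \<rho> ^ k * n ^ k" by (simp add: of_nat_diff)
    then have "(1 - \<rho> ^ k) * n ^ k \<le> real (independence_number (tensor_power G k))"
      using T by (simp add: algebra_simps)
    then show ?thesis
      using n by (simp add: independence_ratio_def card_pverts_tensor_power[OF fin] n_def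
          pos_le_divide_eq)
  qed
  have "(\<lambda>k. 1 - \<rho> ^ k) \<longlonglongrightarrow> 1 - 0"
    using \<rho> by (intro tendsto_intros LIMSEQ_realpow_zero)
  then have "1 \<le> tensor_capacity G"
    using LIMSEQ_le[OF _ tensor_capacity_LIMSEQ[OF fin ne]] ratio by fastforce
  with tensor_capacity_le_1[OF fin ne] show ?thesis by simp
qed

section \<open>Twins in cographs\<close>

text \<open>Stated for a relation on a set, so that it applies to complements and to the vertices
  that are still unmerged.\<close>

definition P4_free_on :: "'a set \<Rightarrow> ('a \<Rightarrow> 'a \<Rightarrow> bool) \<Rightarrow> bool" where
  "P4_free_on S E \<longleftrightarrow> \<not> (\<exists>a\<in>S. \<exists>b\<in>S. \<exists>c\<in>S. \<exists>d\<in>S.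
     E a b \<and> E b c \<and> E c d \<and> \<not> E a c \<and> \<not> E a d \<and> \<not> E b d)"

lemma P4_free_on_subset: "P4_free_on S E \<Longrightarrow> T \<subseteq> S \<Longrightarrow> P4_free_on T E"
  unfolding P4_free_on_def by blast

text \<open>The path on four vertices is self-complementary: a path a, b, c, d of the complement is
  the path b, d, a, c of \<open>E\<close>.\<close>

lemma P4_free_on_complement:
  assumes "P4_free_on S E" "symp E"
  shows "P4_free_on S (\<lambda>x y. x \<noteq> y \<and> \<not> E x y)"
  unfolding P4_free_on_def
proof (intro notI, elim bexE conjE)
  fix a b c d
  assume S: "a \<in> S" "b \<in> S" "c \<in> S" "d \<in> S"
    and E: "a \<noteq> b" "\<not> E a b" "b \<noteq> c" "\<not> E b c" "c \<noteq> d" "\<not> E c d"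
    "\<not> (a \<noteq> c \<and> \<not> E a c)" "\<not> (a \<noteq> d \<and> \<not> E a d)" "\<not> (b \<noteq> d \<and> \<not> E b d)"
  have "E b d" "E d a" "E a c" "\<not> E b a" "\<not> E b c" "\<not> E d c"
    using E \<open>symp E\<close> by (metis sympD)+
  with S assms(1) show False
    unfolding P4_free_on_def by blast
qed

text \<open>\<open>E\<close> or its complement is disconnected on \<open>S\<close>. Keeping both
  alternatives in one predicate makes it invariant under complements, so only the disconnected case
  needs an argument.\<close>

definition splits :: "('a \<Rightarrow> 'a \<Rightarrow> bool) \<Rightarrow> 'a set \<Rightarrow> 'a set \<Rightarrow> bool" where
  "splits E S X \<longleftrightarrow> X \<subseteq> S \<and> X \<noteq> {} \<and> X \<noteq> S \<and>
     ((\<forall>x\<in>X. \<forall>y\<in>S - X. \<not> E x y) \<or> (\<forall>x\<in>X. \<forall>y\<in>S - X. E x y))"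

lemma splits_complement_iff: "splits (\<lambda>x y. x \<noteq> y \<and> \<not> E x y) S X \<longleftrightarrow> splits E S X"
proof -
  have "(\<forall>x\<in>X. \<forall>y\<in>S - X. \<not> (x \<noteq> y \<and> \<not> E x y)) \<longleftrightarrow> (\<forall>x\<in>X. \<forall>y\<in>S - X. E x y)"
    "(\<forall>x\<in>X. \<forall>y\<in>S - X. x \<noteq> y \<and> \<not> E x y) \<longleftrightarrow> (\<forall>x\<in>X. \<forall>y\<in>S - X. \<not> E x y)"
    by (metis DiffD2)+
  then show ?thesis
    unfolding splits_def by (simp only: disj_commute)
qed

text \<open>Let \<open>C\<close> be the component in \<open>S\<close> of a non-neighbour
  \<open>y\<close> of \<open>z\<close>. If \<open>z\<close> has neighbours both in \<open>C\<close>
  and in \<open>S - C\<close>, an induced path arises; otherwise \<open>C\<close> or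
  \<open>S - C\<close> is still cut off after adding \<open>z\<close>.\<close>

lemma splits_insert_if_disconnected:
  assumes sym: "symp E" and P4: "P4_free_on (insert z S) E" and z: "z \<notin> S"
    and X: "X \<subseteq> S" "X \<noteq> {}" "X \<noteq> S" "\<forall>x\<in>X. \<forall>y\<in>S - X. \<not> E x y"
  shows "\<exists>Y. splits E (insert z S) Y"
proof (cases "\<forall>y\<in>S. E z y")
  case True
  then have "splits E (insert z S) {z}"
    using X z by (auto simp: splits_def)
  then show ?thesis ..
next
  case False
  then obtain y where y: "y \<in> S" "\<not> E z y" by blast
  have E_sym: "E a b \<Longrightarrow> E b a" for a b using sym by (rule sympD)
  define R where "R = {(a, b). a \<in> S \<and> b \<in> S \<and> E a b}"
  define C where "C = R\<^sup>* `` {y}"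
  have yC: "y \<in> C" by (simp add: C_def)
  have closed: "b \<in> C" if "a \<in> C" "a \<in> S" "b \<in> S" "E a b" for a b
    using that by (auto simp: C_def R_def intro: rtrancl_into_rtrancl)
  have ind: "C \<subseteq> T" if "y \<in> T" "\<And>a b. a \<in> T \<Longrightarrow> (a, b) \<in> R \<Longrightarrow> b \<in> T" for T
  proof
    fix c assume "c \<in> C"
    then have "(y, c) \<in> R\<^sup>*" by (simp add: C_def)
    then show "c \<in> T" by induction (use that in auto)
  qed
  have CS: "C \<subseteq> S" using y by (intro ind) (auto simp: R_def)
  have "C \<subseteq> X \<or> C \<subseteq> S - X"
  proof (cases "y \<in> X")
    case True
    then have "C \<subseteq> X" using X by (intro ind) (auto simp: R_def)
    then show ?thesis ..
  next
    case False
    have "C \<subseteq> S - X"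
    proof (rule ind)
      show "y \<in> S - X" using False y by simp
      show "b \<in> S - X" if "a \<in> S - X" "(a, b) \<in> R" for a b
        using that X(4) E_sym unfolding R_def by blast
    qed
    then show ?thesis ..
  qed
  then have C_ne: "C \<noteq> S" using X by blast
  have between: "\<not> E a b" if "a \<in> C" "b \<in> S - C" for a b
    using that closed CS by blast
  show ?thesis
  proof (cases "\<exists>c\<in>C. E z c")
    case False
    then have "splits E (insert z S) C"
      using CS yC z between E_sym by (auto simp: splits_def)
    then show ?thesis ..
  next
    case True
    \<comment> \<open>Otherwise non-adjacency to \<open>z\<close> would spread from \<open>y\<close>
      along the edges to all of \<open>C\<close>.\<close>
    have "\<exists>a\<in>C. \<exists>b\<in>C. E a b \<and> E z a \<and> \<not> E z b"
    proof (rule ccontr)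
      assume no: "\<not> ?thesis"
      have "C \<subseteq> {c \<in> C. \<not> E z c}"
      proof (rule ind)
        show "y \<in> {c \<in> C. \<not> E z c}" using yC y by simp
        show "b \<in> {c \<in> C. \<not> E z c}" if "a \<in> {c \<in> C. \<not> E z c}" "(a, b) \<in> R" for a b
        proof -
          have "b \<in> C" "E b a" using that closed[of a b] E_sym[of a b] by (simp_all add: R_def)
          then show ?thesis using that(1) no by blast
        qed
      qed
      with True show False by blast
    qed
    then obtain a b where ab: "a \<in> C" "b \<in> C" "E a b" "E z a" "\<not> E z b" by blast
    show ?thesis
    proof (cases "\<exists>x\<in>S - C. E z x")
      case True
      then obtain x where x: "x \<in> S - C" "E z x" by blast
      \<comment> \<open>The induced path is x, z, a, b.\<close>
      then have "E x z" "\<not> E x a" "\<not> E x b" using ab between E_sym by blast+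
      with ab x P4 CS show ?thesis unfolding P4_free_on_def by blast
    next
      case False
      have "\<not> E x w" if "x \<in> S - C" "w \<in> insert z S - (S - C)" for x w
        using that False between[of w x] E_sym[of x w] by blast
      moreover have "S - C \<subseteq> insert z S" "S - C \<noteq> {}" "S - C \<noteq> insert z S"
        using CS C_ne z by blast+
      ultimately have "splits E (insert z S) (S - C)"
        unfolding splits_def by blast
      then show ?thesis ..
    qed
  qed
qed

text \<open>Vertices are added one at a time. If the old set splits as a join, the previous lemma is
  applied to the complement, which is P4-free as well.\<close>

lemma P4_free_ex_splits:
  assumes "finite S" "symp E" "P4_free_on S E" "2 \<le> card S"
  shows "\<exists>X. splits E S X"
  using assms(1,3,4)
proof (induction S rule: finite_induct)
  case empty
  then show ?case by simp
next
  case (insert z S)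
  show ?case
  proof (cases "2 \<le> card S")
    case True
    have "P4_free_on S E" using insert.prems(1) by (rule P4_free_on_subset) auto
    then obtain X where X: "splits E S X" using insert.IH True by blast
    show ?thesis
    proof (cases "\<forall>x\<in>X. \<forall>y\<in>S - X. \<not> E x y")
      case True
      then show ?thesis
        using X insert.hyps insert.prems assms(2)
        by (intro splits_insert_if_disconnected[where X = X]) (auto simp: splits_def)
    next
      case False
      let ?E = "\<lambda>x y. x \<noteq> y \<and> \<not> E x y"
      have "\<forall>x\<in>X. \<forall>y\<in>S - X. \<not> ?E x y"
        using False X by (auto simp: splits_def)
      moreover have "symp ?E" using assms(2) by (auto simp: symp_def)
      moreover have "P4_free_on (insert z S) ?E"
        using insert.prems(1) assms(2) by (rule P4_free_on_complement)
      ultimately have "\<exists>Y. splits ?E (insert z S) Y"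
        using X insert.hyps
        by (intro splits_insert_if_disconnected[where X = X]) (auto simp: splits_def)
      then show ?thesis by (simp only: splits_complement_iff)
    qed
  next
    case False
    then have "card S = 1" using insert by simp
    then obtain y where "S = {y}" by (auto simp: card_1_singleton_iff)
    then have "splits E (insert z S) {z}" using insert.hyps by (auto simp: splits_def)
    then show ?thesis ..
  qed
qed

definition twins_in :: "('a \<Rightarrow> 'a \<Rightarrow> bool) \<Rightarrow> 'a set \<Rightarrow> 'a \<Rightarrow> 'a \<Rightarrow> bool" where
  "twins_in E S u v \<longleftrightarrow> u \<in> S \<and> v \<in> S \<and> u \<noteq> v \<and> (\<forall>w\<in>S - {u, v}. E u w \<longleftrightarrow> E v w)"

lemma twins_in_commute: "twins_in E S u v \<longleftrightarrow> twins_in E S v u"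
  unfolding twins_in_def by blast

text \<open>Twins inside one part of a split remain twins in \<open>S\<close>, since the other part
  is adjacent to both or to neither. If both parts are singletons, they are twins
  themselves.\<close>

lemma P4_free_ex_twins:
  assumes "finite S" "symp E" "P4_free_on S E" "2 \<le> card S"
  shows "\<exists>u v. twins_in E S u v"
  using assms(1,3,4)
proof (induction S rule: finite_psubset_induct)
  case (psubset S)
  obtain X where X: "splits E S X"
    using P4_free_ex_splits psubset assms(2) by blast
  have lift: "twins_in E S u v" if "twins_in E T u v" "T = X \<or> T = S - X" for T u v
    using that X sympD[OF assms(2)] unfolding splits_def twins_in_def by blast
  have XS: "X \<subset> S" "S - X \<subset> S" using X by (auto simp: splits_def)
  have P4: "P4_free_on X E" "P4_free_on (S - X) E"
    using psubset.prems(1) XS by (blast intro: P4_free_on_subset)+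
  consider "2 \<le> card X" | "2 \<le> card (S - X)" | "card X \<le> 1" "card (S - X) \<le> 1"
    by linarith
  then show ?case
  proof cases
    case 1
    then show ?thesis using psubset.IH[OF XS(1) P4(1)] lift by blast
  next
    case 2
    then show ?thesis using psubset.IH[OF XS(2) P4(2)] lift by blast
  next
    case 3
    moreover have "finite X" "finite (S - X)" "X \<noteq> {}" "S - X \<noteq> {}"
      using psubset.hyps XS X by (auto simp: splits_def intro: finite_subset)
    ultimately have "card X = 1" "card (S - X) = 1"
      by (simp_all add: le_antisym Suc_le_eq card_gt_0_iff)
    then obtain x y where "X = {x}" "S - X = {y}" by (metis card_1_singletonE)
    then have "S = {x, y}" "x \<noteq> y" using XS by auto
    then have "twins_in E S x y" by (auto simp: twins_in_def)
    then show ?thesis by blast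
  qed
qed

section \<open>Merging twin modules\<close>

text \<open>
  The number \<open>f\<close> is the maximum of \<open>p |I| - q |N(I)|\<close> over the independent sets \<open>I\<close> of the subgraph
  induced by \<open>X\<close>, stated without subtraction.
\<close>

definition max_gain :: "nat \<Rightarrow> nat \<Rightarrow> 'a pair_pre_digraph \<Rightarrow> 'a set \<Rightarrow> nat \<Rightarrow> bool" where
  "max_gain p q G X f \<longleftrightarrow>
     (\<exists>I. independent_set G I \<and> I \<subseteq> X \<and> p * card I = q * card (nbrs G I \<inter> X) + f) \<and>
     (\<forall>I. independent_set G I \<longrightarrow> I \<subseteq> X \<longrightarrow> p * card I \<le> q * card (nbrs G I \<inter> X) + f)"

lemma nbrs_empty [simp]: "nbrs G {} = {}"
  by (simp add: nbrs_def)

lemma independent_set_empty: "independent_set G {}"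
  by (simp add: independent_set_def)

lemma independent_set_subset: "independent_set G I \<Longrightarrow> J \<subseteq> I \<Longrightarrow> independent_set G J"
  by (auto simp: independent_set_def)

lemma max_gain_le:
  assumes "max_gain p q G X f" "finite X"
  shows "f \<le> p * card X"
proof -
  obtain I where "I \<subseteq> X" "p * card I = q * card (nbrs G I \<inter> X) + f"
    using assms(1) by (auto simp: max_gain_def)
  moreover have "p * card I \<le> p * card X"
    using \<open>I \<subseteq> X\<close> assms(2) by (simp add: card_mono)
  ultimately show ?thesis by linarith
qed

lemma max_gain_singleton:
  assumes "v \<in> pverts G" "(v, v) \<notin> parcs G"
  shows "max_gain p q G {v} p"
proof -
  have "independent_set G {v}" "nbrs G {v} \<inter> {v} = {}"
    using assms by (auto simp: independent_set_def nbrs_def)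
  then have "\<exists>I. independent_set G I \<and> I \<subseteq> {v} \<and> p * card I = q * card (nbrs G I \<inter> {v}) + p"
    by (intro exI[of _ "{v}"]) simp
  moreover have "p * card I \<le> p" if "I \<subseteq> {v}" for I
    using that card_mono[of "{v}" I] by simp
  ultimately show ?thesis
    unfolding max_gain_def by (simp add: trans_le_add2)
qed

text \<open>No arc crosses, so independent sets and their neighbourhoods split along
  \<open>X\<close> and \<open>Y\<close>, and the two optima add up.\<close>

lemma max_gain_disjoint_union:
  assumes f: "max_gain p q G X f" and g: "max_gain p q G Y g"
    and fin: "finite X" "finite Y" and disj: "X \<inter> Y = {}"
    and no: "\<forall>x\<in>X. \<forall>y\<in>Y. (x, y) \<notin> parcs G \<and> (y, x) \<notin> parcs G"
  shows "max_gain p q G (X \<union> Y) (f + g)"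
proof -
  have card_nbrs: "card (nbrs G (I \<union> J) \<inter> (X \<union> Y)) = card (nbrs G I \<inter> X) + card (nbrs G J \<inter> Y)"
    if "I \<subseteq> X" "J \<subseteq> Y" for I J
  proof -
    have "nbrs G (I \<union> J) \<inter> (X \<union> Y) = (nbrs G I \<inter> X) \<union> (nbrs G J \<inter> Y)"
      using that no by (auto simp: nbrs_def)
    then show ?thesis
      using fin disj by (simp only:) (intro card_Un_disjoint, auto)
  qed
  have card_Un: "card (I \<union> J) = card I + card J" if "I \<subseteq> X" "J \<subseteq> Y" for I J
    using that fin disj by (intro card_Un_disjoint) (auto intro: finite_subset)
  obtain I where I: "independent_set G I" "I \<subseteq> X" "p * card I = q * card (nbrs G I \<inter> X) + f"
    using f by (auto simp: max_gain_def)
  obtain J where J: "independent_set G J" "J \<subseteq> Y" "p * card J = q * card (nbrs G J \<inter> Y) + g"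
    using g by (auto simp: max_gain_def)
  have "independent_set G (I \<union> J)"
    using I J no unfolding independent_set_def by blast
  moreover have "p * card (I \<union> J) = q * card (nbrs G (I \<union> J) \<inter> (X \<union> Y)) + (f + g)"
    using I J by (simp add: card_nbrs card_Un add_mult_distrib2)
  moreover have "p * card K \<le> q * card (nbrs G K \<inter> (X \<union> Y)) + (f + g)"
    if K: "independent_set G K" "K \<subseteq> X \<union> Y" for K
  proof -
    have K_eq: "K = (K \<inter> X) \<union> (K \<inter> Y)" using K by blast
    have "p * card (K \<inter> X) \<le> q * card (nbrs G (K \<inter> X) \<inter> X) + f"
      "p * card (K \<inter> Y) \<le> q * card (nbrs G (K \<inter> Y) \<inter> Y) + g"
      using f g independent_set_subset[OF K(1)] by (simp_all add: max_gain_def)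
    then show ?thesis
      by (subst (1 2) K_eq) (simp add: card_nbrs card_Un add_mult_distrib2)
  qed
  ultimately show ?thesis
    unfolding max_gain_def using I(2) J(2) by (metis Un_mono)
qed

text \<open>A nonempty independent set lies on one side and has the whole other side as neighbours,
  at a cost of \<open>q\<close> per vertex. When neither side stays positive, the empty set is
  optimal, which truncated subtraction renders as 0.\<close>

lemma max_gain_join:
  assumes f: "max_gain p q G X f" and g: "max_gain p q G Y g"
    and fin: "finite X" "finite Y" and disj: "X \<inter> Y = {}" and V: "X \<subseteq> pverts G" "Y \<subseteq> pverts G"
    and all: "\<forall>x\<in>X. \<forall>y\<in>Y. (x, y) \<in> parcs G \<and> (y, x) \<in> parcs G"
  shows "max_gain p q G (X \<union> Y) (max (f - q * card Y) (g - q * card X))"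
proof -
  have cn: "card (nbrs G I \<inter> (S \<union> T)) = card (nbrs G I \<inter> S) + card T"
    if "I \<subseteq> S" "I \<noteq> {}" "(S, T) = (X, Y) \<or> (S, T) = (Y, X)" for I S T
  proof -
    have "nbrs G I \<inter> (S \<union> T) = (nbrs G I \<inter> S) \<union> T"
      using that all V by (auto simp: nbrs_def)
    then show ?thesis
      using fin disj that(3) by (simp only:) (intro card_Un_disjoint, auto)
  qed
  have cnX: "q * card (nbrs G I \<inter> (X \<union> Y)) = q * card (nbrs G I \<inter> X) + q * card Y"
    if "I \<subseteq> X" "I \<noteq> {}" for I
    using cn[of I X Y] that by (simp add: add_mult_distrib2)
  have cnY: "q * card (nbrs G I \<inter> (X \<union> Y)) = q * card (nbrs G I \<inter> Y) + q * card X"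
    if "I \<subseteq> Y" "I \<noteq> {}" for I
    using cn[of I Y X] that by (simp add: add_mult_distrib2 Un_commute)
  let ?m = "max (f - q * card Y) (g - q * card X)"
  have "\<exists>I. independent_set G I \<and> I \<subseteq> X \<union> Y \<and> p * card I = q * card (nbrs G I \<inter> (X \<union> Y)) + ?m"
  proof -
    consider "?m = 0" | "?m = f - q * card Y" "q * card Y < f" | "?m = g - q * card X" "q * card X < g"
      by linarith
    then show ?thesis
    proof cases
      case 1
      then show ?thesis using independent_set_empty by (intro exI[of _ "{}"]) simp
    next
      case 2
      obtain I where I: "independent_set G I" "I \<subseteq> X" "p * card I = q * card (nbrs G I \<inter> X) + f"
        using f by (auto simp: max_gain_def)
      have "I \<noteq> {}" using I(3) 2 by auto
      then have "p * card I = q * card (nbrs G I \<inter> (X \<union> Y)) + ?m"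
        using cnX[of I] I 2 by linarith
      then show ?thesis using I by blast
    next
      case 3
      obtain I where I: "independent_set G I" "I \<subseteq> Y" "p * card I = q * card (nbrs G I \<inter> Y) + g"
        using g by (auto simp: max_gain_def)
      have "I \<noteq> {}" using I(3) 3 by auto
      then have "p * card I = q * card (nbrs G I \<inter> (X \<union> Y)) + ?m"
        using cnY[of I] I 3 by linarith
      then show ?thesis using I by blast
    qed
  qed
  moreover have "p * card K \<le> q * card (nbrs G K \<inter> (X \<union> Y)) + ?m"
    if K: "independent_set G K" "K \<subseteq> X \<union> Y" for K
  proof -
    have "K \<subseteq> X \<or> K \<subseteq> Y"
      using K all unfolding independent_set_def by blast
    then consider "K = {}" | "K \<noteq> {}" "K \<subseteq> X" | "K \<noteq> {}" "K \<subseteq> Y" by blast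
    then show ?thesis
    proof cases
      case 2
      have "p * card K \<le> q * card (nbrs G K \<inter> X) + f"
        using f K(1) 2 by (simp add: max_gain_def)
      then show ?thesis using cnX[OF 2(2,1)] by linarith
    next
      case 3
      have "p * card K \<le> q * card (nbrs G K \<inter> Y) + g"
        using g K(1) 3 by (simp add: max_gain_def)
      then show ?thesis using cnY[OF 3(2,1)] by linarith
    qed simp
  qed
  ultimately show ?thesis unfolding max_gain_def by blast
qed

lemma max_gain_eq_0_iff:
  assumes "max_gain p q G (pverts G) f"
  shows "f = 0 \<longleftrightarrow> expanding p q G"
proof
  have N: "nbrs G I \<inter> pverts G = nbrs G I" for I
    using nbrs_subset[of G I] by auto
  show "expanding p q G" if "f = 0"
    using assms that by (auto simp: expanding_def max_gain_def N independent_set_def)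
  show "f = 0" if "expanding p q G"
  proof -
    obtain I where I: "independent_set G I" "p * card I = q * card (nbrs G I) + f"
      using assms by (auto simp: max_gain_def N)
    with that show ?thesis by (fastforce simp: expanding_def)
  qed
qed

section \<open>Quotients by modules and their gain tables\<close>

text \<open>\<open>M v\<close> is the set of vertices merged into \<open>v\<close>, empty once
  \<open>v\<close> itself has been merged away. Adjacency between blocks is read off their
  representatives, so the adjacency matrix never has to change.\<close>

definition module_partition :: "nat \<Rightarrow> nat pair_pre_digraph \<Rightarrow> (nat \<Rightarrow> nat set) \<Rightarrow> bool" where
  "module_partition n G M \<longleftrightarrow>
     (\<Union>v<n. M v) = {..<n} \<and> (\<forall>v<n. M v = {} \<or> v \<in> M v) \<and>
     (\<forall>u<n. \<forall>v<n. u \<noteq> v \<longrightarrow> M u \<inter> M v = {}) \<and>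
     (\<forall>u<n. \<forall>v<n. u \<noteq> v \<longrightarrow> (\<forall>x\<in>M u. \<forall>y\<in>M v. (x, y) \<in> parcs G \<longleftrightarrow> (u, v) \<in> parcs G))"

text \<open>The program keeps only sizes and gains; the blocks exist in the proof alone.
  \<open>sz v = 0\<close> marks a vertex merged away, whose entry \<open>F v\<close> is
  arbitrary.\<close>

definition gain_tables :: "nat \<Rightarrow> nat \<Rightarrow> nat \<Rightarrow> nat pair_pre_digraph \<Rightarrow>
    (nat \<Rightarrow> nat) \<Rightarrow> (nat \<Rightarrow> nat) \<Rightarrow> bool" where
  "gain_tables p q n G sz F \<longleftrightarrow> (\<exists>M. module_partition n G M \<and>
     (\<forall>v<n. sz v = card (M v) \<and> (M v \<noteq> {} \<longrightarrow> max_gain p q G (M v) (F v))))"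

definition active :: "nat \<Rightarrow> (nat \<Rightarrow> nat) \<Rightarrow> nat set" where
  "active n sz = {v. v < n \<and> sz v \<noteq> 0}"

definition twins :: "nat \<Rightarrow> nat pair_pre_digraph \<Rightarrow> (nat \<Rightarrow> nat) \<Rightarrow> nat \<Rightarrow> nat \<Rightarrow> bool" where
  "twins n G sz = twins_in (\<lambda>x y. (x, y) \<in> parcs G) (active n sz)"

lemma finite_active [simp]: "finite (active n sz)"
  by (simp add: active_def)

lemma module_partition_finite: "module_partition n G M \<Longrightarrow> v < n \<Longrightarrow> finite (M v) \<and> M v \<subseteq> {..<n}"
  using finite_subset[of "M v" "{..<n}"] UN_upper[of v "{..<n}" M]
  by (simp add: module_partition_def)

locale cograph_on =
  fixes n :: nat and G :: "nat pair_pre_digraph"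
  assumes n: "1 \<le> n" and V: "pverts G = {..<n}" and cograph: "cograph G"
begin

lemma arcs_sym: "sym (parcs G)"
proof -
  have "pair_graph G" using cograph by (simp add: cograph_def)
  then interpret pair_graph G .
  show ?thesis using sym_arcs by (auto simp: symmetric_def)
qed

lemma arcs_irrefl: "(v, v) \<notin> parcs G"
proof -
  have "pair_graph G" using cograph by (simp add: cograph_def)
  then interpret pair_graph G .
  show ?thesis using no_loops' by auto
qed

lemma arcs_subset: "parcs G \<subseteq> {..<n} \<times> {..<n}"
proof -
  have "pair_graph G" using cograph by (simp add: cograph_def)
  then interpret pair_graph G .
  show ?thesis using V in_arcsD1 in_arcsD2 by auto
qed

lemma arc_commute: "(u, v) \<in> parcs G \<longleftrightarrow> (v, u) \<in> parcs G"
  using arcs_sym unfolding sym_def by blast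

lemma P4_free: "S \<subseteq> {..<n} \<Longrightarrow> P4_free_on S (\<lambda>x y. (x, y) \<in> parcs G)"
  unfolding P4_free_on_def
proof (intro notI, elim bexE conjE)
  fix a b c d
  assume "S \<subseteq> {..<n}" "a \<in> S" "b \<in> S" "c \<in> S" "d \<in> S" and E: "(a, b) \<in> parcs G" "(b, c) \<in> parcs G"
    "(c, d) \<in> parcs G" "(a, c) \<notin> parcs G" "(a, d) \<notin> parcs G" "(b, d) \<notin> parcs G"
  \<comment> \<open>The six adjacency conditions force distinctness for a symmetric relation without
    loops.\<close>
  moreover have "distinct [a, b, c, d]"
    using E arcs_irrefl arc_commute by auto
  ultimately have "induced_P4 G a b c d"
    using V by (auto simp: induced_P4_def)
  then show False using cograph by (auto simp: cograph_def)
qed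

text \<open>The order \<open>v < u\<close> fixes the direction of merging: always into the smaller
  index. Hence vertex 0 is never emptied, and the final gain is found in \<open>F 0\<close>.\<close>

lemma ex_twins:
  assumes "2 \<le> card (active n sz)"
  shows "\<exists>u v. v < u \<and> twins n G sz u v"
proof -
  have "\<exists>u v. twins n G sz u v"
    unfolding twins_def
    by (rule P4_free_ex_twins)
      (use assms arc_commute in \<open>auto simp: symp_def active_def intro!: P4_free\<close>)
  then obtain u v where uv: "twins n G sz u v" by blast
  then have "u \<noteq> v" "twins n G sz v u"
    unfolding twins_def by (simp_all add: twins_in_def[of _ _ u v] twins_in_commute[of _ _ v u])
  with uv show ?thesis by (meson nat_neq_iff)
qed

lemma gain_tables_initial:
  assumes "\<forall>v<n. sz v = 1" "\<forall>v<n. F v = p"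
  shows "gain_tables p q n G sz F"
  unfolding gain_tables_def module_partition_def
  using assms V max_gain_singleton[OF _ arcs_irrefl]
  by (intro exI[of _ "\<lambda>v. {v}"]) auto

text \<open>Keeps the cells of the program polynomially small: a gain never exceeds \<open>p\<close>
  times the size of its block.\<close>

lemma gain_tables_bounds:
  assumes "gain_tables p q n G sz F" "v < n" "sz v \<noteq> 0"
  shows "F v \<le> p * n" "sz v \<le> n"
proof -
  obtain M where M: "module_partition n G M" "sz v = card (M v)"
      "M v \<noteq> {} \<Longrightarrow> max_gain p q G (M v) (F v)"
    using assms by (auto simp: gain_tables_def)
  have fin: "finite (M v)" "M v \<subseteq> {..<n}" using module_partition_finite[OF M(1) assms(2)] by auto
  then have "card (M v) \<le> n" using card_mono[of "{..<n}" "M v"] by simp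
  moreover have "F v \<le> p * card (M v)"
    using M fin assms(3) by (intro max_gain_le) auto
  ultimately show "F v \<le> p * n" "sz v \<le> n"
    using M(2) by (auto intro: le_trans)
qed

text \<open>Twins of the quotient see every other block alike, so their union is again a module and
  \<open>v\<close> can represent it. Whether they are adjacent decides between join and disjoint
  union.\<close>

lemma gain_tables_merge:
  assumes gt: "gain_tables p q n G sz F" and uv: "v < u" "u < n" and tw: "twins n G sz u v"
    and f: "f = (if (u, v) \<in> parcs G
              then max (F v - q * sz u) (F u - q * sz v) else F u + F v)"
  shows "gain_tables p q n G (sz(v := sz u + sz v, u := 0)) (F(v := f))"
proof -
  obtain M where M: "module_partition n G M"
    and tab: "\<And>v. v < n \<Longrightarrow> sz v = card (M v)"
      "\<And>v. v < n \<Longrightarrow> M v \<noteq> {} \<Longrightarrow> max_gain p q G (M v) (F v)"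
    using gt by (auto simp: gain_tables_def)
  have vn: "v < n" and neq: "u \<noteq> v" using uv by auto
  have fin: "finite (M w)" "M w \<subseteq> {..<n}" if "w < n" for w
    using module_partition_finite[OF M that] by auto
  have ne: "M w \<noteq> {} \<longleftrightarrow> w \<in> active n sz" if "w < n" for w
    using that fin[OF that] tab(1)[OF that] by (auto simp: active_def card_gt_0_iff)
  have uvne: "M u \<noteq> {}" "M v \<noteq> {}"
    using tw uv vn ne by (auto simp: twins_def twins_in_def)
  have disj: "M a \<inter> M b = {}" if "a < n" "b < n" "a \<noteq> b" for a b
    using M that by (simp add: module_partition_def)
  have adj: "(x, y) \<in> parcs G \<longleftrightarrow> (a, b) \<in> parcs G"
    if "x \<in> M a" "y \<in> M b" "a < n" "b < n" "a \<noteq> b" for a b x y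
    using M that by (simp add: module_partition_def)
  define M' where "M' = M(v := M u \<union> M v, u := {})"
  have M'_simps: "M' u = {}" "M' v = M u \<union> M v" "\<And>w. w \<noteq> u \<Longrightarrow> w \<noteq> v \<Longrightarrow> M' w = M w"
    using neq by (auto simp: M'_def)
  have "module_partition n G M'"
    unfolding module_partition_def
  proof (intro conjI allI impI ballI)
    have "{..<n} = {..<n} - {u, v} \<union> {u, v}" using uv vn by auto
    then have "(\<Union>w<n. N w) = (\<Union>w\<in>{..<n} - {u, v}. N w) \<union> (N u \<union> N v)" for N :: "nat \<Rightarrow> nat set"
      by (metis UN_Un UN_insert Un_empty_right UN_empty)
    then have "(\<Union>w<n. M' w) = (\<Union>w<n. M w)"
      by (simp add: M'_simps)
    then show "(\<Union>w<n. M' w) = {..<n}" using M by (simp add: module_partition_def)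
  next
    fix w assume "w < n"
    then show "M' w = {} \<or> w \<in> M' w"
      using M vn by (auto simp: M'_def module_partition_def uvne)
  next
    fix a b assume "a < n" "b < n" "a \<noteq> b"
    then show "M' a \<inter> M' b = {}"
      using disj[of a b] disj[of u b] disj[of a u] uv by (auto simp: M'_def)
  next
    fix a b x y assume ab: "a < n" "b < n" "a \<noteq> b" and xy: "x \<in> M' a" "y \<in> M' b"
    have abu: "a \<noteq> u" "b \<noteq> u" using xy by (auto simp: M'_def)
    \<comment> \<open>This lets \<open>v\<close> answer for the vertices that come from
      \<open>M u\<close>.\<close>
    have tw': "(u, w) \<in> parcs G \<longleftrightarrow> (v, w) \<in> parcs G"
      if "w < n" "w \<noteq> u" "w \<noteq> v" "M w \<noteq> {}" for w
      using tw that ne by (simp add: twins_def twins_in_def)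
    consider "a \<noteq> v" "b \<noteq> v" | "a = v" "x \<in> M v" | "a = v" "x \<in> M u" | "b = v" "y \<in> M v"
      | "b = v" "y \<in> M u"
      using xy by (auto simp: M'_def split: if_splits)
    then show "(x, y) \<in> parcs G \<longleftrightarrow> (a, b) \<in> parcs G"
    proof cases
      case 1
      then show ?thesis using xy adj ab abu by (simp add: M'_simps)
    next
      case 2
      then show ?thesis using xy adj[of x v y b] ab abu by (simp add: M'_simps)
    next
      case 3
      then have y: "y \<in> M b" using xy ab abu by (simp add: M'_simps)
      then show ?thesis using 3 adj[of x u y b] ab abu uv tw'[of b] by auto
    next
      case 4
      then show ?thesis using xy adj[of x a y v] ab abu by (simp add: M'_simps)
    next
      case 5
      then have x: "x \<in> M a" using xy ab abu by (simp add: M'_simps)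
      then show ?thesis
        using 5 adj[of x a y u] ab abu uv tw'[of a] arc_commute[of a u] arc_commute[of a v] by auto
    qed
  qed
  moreover have "max_gain p q G (M u \<union> M v) f"
  proof (cases "(u, v) \<in> parcs G")
    case True
    have "max_gain p q G (M u \<union> M v) (max (F u - q * card (M v)) (F v - q * card (M u)))"
    proof (rule max_gain_join)
      show "\<forall>x\<in>M u. \<forall>y\<in>M v. (x, y) \<in> parcs G \<and> (y, x) \<in> parcs G"
        using adj[of _ u _ v] True uv vn neq arc_commute by blast
    qed (use tab uv vn uvne fin disj neq V in auto)
    then show ?thesis using True f tab uv vn by (simp add: max.commute)
  next
    case False
    have "max_gain p q G (M u \<union> M v) (F u + F v)"
    proof (rule max_gain_disjoint_union)
      show "\<forall>x\<in>M u. \<forall>y\<in>M v. (x, y) \<notin> parcs G \<and> (y, x) \<notin> parcs G"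
        using adj[of _ u _ v] False uv vn neq arc_commute by blast
    qed (use tab uv vn uvne fin disj neq in auto)
    then show ?thesis using False f by simp
  qed
  moreover have "card (M u \<union> M v) = card (M u) + card (M v)"
    using fin uv vn disj neq by (intro card_Un_disjoint) auto
  ultimately show ?thesis
    unfolding gain_tables_def
    by (intro exI[of _ M']) (use tab uv vn neq in \<open>auto simp: M'_def\<close>)
qed

lemma card_active_merge:
  assumes "v < u" "u < n" "twins n G sz u v"
  shows "card (active n (sz(v := sz u + sz v, u := 0))) = card (active n sz) - 1"
proof -
  have "active n (sz(v := sz u + sz v, u := 0)) = active n sz - {u}" "u \<in> active n sz"
    using assms by (auto simp: active_def twins_def twins_in_def)
  then show ?thesis by simp
qed

lemma gain_tables_final:
  assumes gt: "gain_tables p q n G sz F" and "card (active n sz) \<le> 1" "sz 0 \<noteq> 0"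
  shows "F 0 = 0 \<longleftrightarrow> expanding p q G"
proof -
  obtain M where M: "module_partition n G M"
    and tab: "\<And>v. v < n \<Longrightarrow> sz v = card (M v)"
      "\<And>v. v < n \<Longrightarrow> M v \<noteq> {} \<Longrightarrow> max_gain p q G (M v) (F v)"
    using gt by (auto simp: gain_tables_def)
  have 0: "0 < n" using n by simp
  then have "0 \<in> active n sz" using assms(3) by (simp add: active_def)
  then have "active n sz = {0}"
    using assms(2) by (metis One_nat_def card_le_Suc0_iff_eq finite_active is_singletonI' is_singleton_def singletonD empty_iff)
  then have "M v = {}" if "v < n" "v \<noteq> 0" for v
    using that tab(1)[OF that(1)] module_partition_finite[OF M that(1)]
    by (metis (mono_tags, lifting) active_def card_0_eq mem_Collect_eq singletonD)
  then have "(\<Union>v<n. M v) = M 0" using 0 by (auto; metis empty_iff)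
  then have "M 0 = pverts G" using M V by (simp add: module_partition_def)
  then show ?thesis
    using tab(2)[OF 0] 0 V by (metis empty_iff lessThan_iff max_gain_eq_0_iff)
qed

section \<open>Reading the capacity off the tested pairs\<close>

text \<open>Any candidate is an upper bound. If some independent set exceeds its neighbourhood, no
  pair with \<open>q \<le> p\<close> is expanding and both sides are 1. Otherwise an
  \<open>I\<close> minimizing |N(I)| / |I| gives the expanding pair p = |N(I)|, q = |I| within the
  tested range, and the lower bound from this same \<open>I\<close> matches.\<close>

lemma tensor_capacity_eq:
  assumes candidate: "(a, b) = (1, 1) \<or> (\<exists>p q. 0 < q \<and> q \<le> p \<and> expanding p q G \<and> a = q \<and> b = p + q)"
    and minimal: "\<And>p q. 0 < q \<Longrightarrow> q \<le> p \<Longrightarrow> p \<le> n \<Longrightarrow> expanding p q G \<Longrightarrow> a * (p + q) \<le> q * b"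
  shows "tensor_capacity G = real a / real b"
proof -
  have fin: "finite (pverts G)" and ne: "pverts G \<noteq> {}" using V n by (auto simp: lessThan_empty_iff)
  have upper: "tensor_capacity G \<le> real a / real b"
    using candidate
    by (elim disjE exE conjE)
      (auto simp: tensor_capacity_le_1[OF fin ne]
        intro: tensor_capacity_le_if_expanding[OF _ fin ne arcs_sym, simplified])
  show ?thesis
  proof (cases "\<exists>I. independent_set G I \<and> card (nbrs G I) < card I")
    case True
    then obtain I where I: "independent_set G I" "card (nbrs G I) < card I" by blast
    have "\<not> expanding p q G" if "0 < q" "q \<le> p" for p q
    proof
      assume "expanding p q G"
      then have "p * card I \<le> q * card (nbrs G I)" using I(1) by (simp add: expanding_def)
      also have "\<dots> < q * card I" using I(2) that(1) by simp
      also have "\<dots> \<le> p * card I" using that(2) by simp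
      finally show False by simp
    qed
    then have "(a, b) = (1, 1)" using candidate by blast
    moreover have "tensor_capacity G = 1"
      using fin arcs_sym _ I by (rule tensor_capacity_eq_1) (use arcs_subset V in simp)
    ultimately show ?thesis by simp
  next
    case False
    then have ge: "card I \<le> card (nbrs G I)" if "independent_set G I" for I
      using that by (meson not_le)
    let ?ratio = "\<lambda>I. real (card (nbrs G I)) / real (card I)"
    let ?C = "{I. independent_set G I \<and> I \<noteq> {}}"
    have "?C \<subseteq> Pow (pverts G)" by (auto simp: independent_set_def)
    then have "finite ?C" using fin by (metis finite_Pow_iff finite_subset)
    moreover have "{0} \<in> ?C" using n V arcs_irrefl by (auto simp: independent_set_def)
    then have "?C \<noteq> {}" by blast
    ultimately obtain I where "I \<in> ?C" and min: "\<And>J. J \<in> ?C \<Longrightarrow> ?ratio I \<le> ?ratio J"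
      using ex_min_if_finite[of "?ratio ` ?C"] by (auto simp: not_less)
    then have I: "independent_set G I" "I \<noteq> {}" by auto
    let ?q = "card I" and ?p = "card (nbrs G I)"
    have q: "0 < ?q" using I finite_independent_set[OF fin I(1)] by (simp add: card_gt_0_iff)
    have pn: "?p \<le> n" using nbrs_subset[of G I] V card_mono[OF fin, of "nbrs G I"] by simp
    have "expanding ?p ?q G"
      unfolding expanding_def
    proof (intro allI impI)
      fix J assume J: "independent_set G J"
      show "?p * card J \<le> ?q * card (nbrs G J)"
      proof (cases "J = {}")
        case False
        then have "0 < card J" using J finite_independent_set[OF fin J] by (simp add: card_gt_0_iff)
        moreover have "?ratio I \<le> ?ratio J" using min J False by simp
        ultimately have "real ?p * real (card J) \<le> real ?q * real (card (nbrs G J))"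
          using q by (simp add: field_simps)
        then show ?thesis by (metis of_nat_le_iff of_nat_mult)
      qed simp
    qed
    then have "a * (?p + ?q) \<le> ?q * b"
      using minimal q ge[OF I(1)] pn by blast
    then have "real a * real (?p + ?q) \<le> real ?q * real b" by (metis of_nat_le_iff of_nat_mult)
    moreover have "0 < b" using candidate by auto
    ultimately have "real a / real b \<le> real ?q / real (?q + ?p)"
      using q by (simp add: field_simps)
    also have "\<dots> \<le> tensor_capacity G"
      using tensor_capacity_ge[OF fin arcs_sym I] .
    finally show ?thesis using upper by simp
  qed
qed

end

section \<open>A Hoare logic with polynomial time bounds\<close>

text \<open>
  If all cells stay bounded by \<open>B\<close> and every loop runs at most \<open>B\<close> times, then the values, costs and
  running times are bounded by these polynomials in \<open>B\<close>.
\<close>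

fun val_bound :: "expr \<Rightarrow> nat poly" where
  "val_bound (Const k) = [:k:]"
| "val_bound (Cell x e) = [:0, 1:]"
| "val_bound (Add e1 e2) = val_bound e1 + val_bound e2"
| "val_bound (Sub e1 e2) = val_bound e1"
| "val_bound (Mul e1 e2) = val_bound e1 * val_bound e2"

fun cost_bound :: "expr \<Rightarrow> nat poly" where
  "cost_bound (Const k) = [:k + 1:]"
| "cost_bound (Cell x e) = cost_bound e + (val_bound e + 1) + [:1, 1:]"
| "cost_bound (Add e1 e2) = cost_bound e1 + cost_bound e2 + (val_bound e1 + 1) + (val_bound e2 + 1)"
| "cost_bound (Sub e1 e2) = cost_bound e1 + cost_bound e2 + (val_bound e1 + 1) + (val_bound e2 + 1)"
| "cost_bound (Mul e1 e2) = cost_bound e1 + cost_bound e2 + (val_bound e1 + 1) + (val_bound e2 + 1)"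

text \<open>Depends on the program text alone. A sum over both branches replaces a maximum, and the
  factor B + 1 of a loop includes the final failing test.\<close>

fun time_bound :: "prog \<Rightarrow> nat poly" where
  "time_bound Skip = 1"
| "time_bound (Assign x e1 e2) =
     cost_bound e1 + cost_bound e2 + (val_bound e1 + 1) + (val_bound e2 + 1)"
| "time_bound (Seq c1 c2) = time_bound c1 + time_bound c2"
| "time_bound (Cond e c1 c2) =
     cost_bound e + (val_bound e + 1) + (time_bound c1 + time_bound c2)"
| "time_bound (While e c) = [:1, 1:] * (cost_bound e + (val_bound e + 1) + time_bound c)"

definition bounded :: "nat \<Rightarrow> store \<Rightarrow> bool" where
  "bounded B s \<longleftrightarrow> (\<forall>x i. s x i \<le> B)"

lemma bounded_update: "bounded B s \<Longrightarrow> k \<le> B \<Longrightarrow> bounded B (s(x := (s x)(i := k)))"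
  by (simp add: bounded_def)

lemma bit_length_le: "m \<le> k \<Longrightarrow> bit_length m \<le> k + 1"
proof -
  assume "m \<le> k"
  have "floor_log m \<le> m"
    by (cases "m = 0")
      (auto intro!: order.trans[OF less_imp_le[OF less_exp] floor_log_exp2_le])
  with \<open>m \<le> k\<close> show ?thesis by (simp add: bit_length_def)
qed

lemma expr_val_le: "bounded B s \<Longrightarrow> expr_val e s \<le> poly (val_bound e) B"
  by (induction e) (auto simp: bounded_def intro: add_mono mult_le_mono order.trans[OF diff_le_self])

lemma expr_cost_le:
  assumes "bounded B s"
  shows "expr_cost e s \<le> poly (cost_bound e) B"
proof (induction e)
  case (Cell x e)
  have "bit_length (s x (expr_val e s)) \<le> B + 1"
    using assms by (intro bit_length_le) (simp add: bounded_def)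
  moreover have "bit_length (expr_val e s) \<le> poly (val_bound e) B + 1"
    using assms by (intro bit_length_le expr_val_le)
  ultimately show ?case using Cell by simp
next
  case (Add e1 e2)
  then show ?case
    using bit_length_le[OF expr_val_le[OF assms], of e1] bit_length_le[OF expr_val_le[OF assms], of e2]
    by simp
next
  case (Sub e1 e2)
  then show ?case
    using bit_length_le[OF expr_val_le[OF assms], of e1] bit_length_le[OF expr_val_le[OF assms], of e2]
    by simp
next
  case (Mul e1 e2)
  then show ?case
    using bit_length_le[OF expr_val_le[OF assms], of e1] bit_length_le[OF expr_val_le[OF assms], of e2]
    by simp
qed (use bit_length_le in simp)

lemma test_cost_le:
  assumes "bounded B s"
  shows "expr_cost e s + bit_length (expr_val e s) \<le> poly (cost_bound e + (val_bound e + 1)) B"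
  using expr_cost_le[OF assms, of e] bit_length_le[OF expr_val_le[OF assms], of e]
  by simp

definition hoare :: "nat \<Rightarrow> (store \<Rightarrow> bool) \<Rightarrow> prog \<Rightarrow> (store \<Rightarrow> bool) \<Rightarrow> bool" where
  "hoare B P c Q \<longleftrightarrow> (\<forall>s. bounded B s \<longrightarrow> P s \<longrightarrow>
     (\<exists>t s'. exec c s t s' \<and> t \<le> poly (time_bound c) B \<and> bounded B s' \<and> Q s'))"

lemma hoare_Skip: "(\<And>s. P s \<Longrightarrow> Q s) \<Longrightarrow> hoare B P Skip Q"
  unfolding hoare_def by (fastforce intro: exec.Skip)

lemma hoare_Assign:
  assumes "\<And>s. P s \<Longrightarrow> bounded B s \<Longrightarrow>
    expr_val e2 s \<le> B \<and> Q (s(x := (s x)(expr_val e1 s := expr_val e2 s)))"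
  shows "hoare B P (Assign x e1 e2) Q"
  unfolding hoare_def
proof (intro allI impI)
  fix s assume s: "bounded B s" "P s"
  have "expr_cost e1 s + expr_cost e2 s + bit_length (expr_val e1 s) + bit_length (expr_val e2 s)
      \<le> poly (time_bound (Assign x e1 e2)) B"
    using test_cost_le[OF s(1), of e1] test_cost_le[OF s(1), of e2] by simp
  with s assms exec.Assign bounded_update show
    "\<exists>t s'. exec (Assign x e1 e2) s t s' \<and> t \<le> poly (time_bound (Assign x e1 e2)) B \<and>
       bounded B s' \<and> Q s'"
    by blast
qed

lemma hoare_Seq:
  assumes "hoare B P c1 Q" "hoare B Q c2 R"
  shows "hoare B P (Seq c1 c2) R"
  unfolding hoare_def
proof (intro allI impI)
  fix s assume "bounded B s" "P s"
  then obtain t1 s1 where 1: "exec c1 s t1 s1" "t1 \<le> poly (time_bound c1) B" "bounded B s1" "Q s1"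
    using assms(1) by (auto simp: hoare_def)
  then obtain t2 s2 where "exec c2 s1 t2 s2" "t2 \<le> poly (time_bound c2) B" "bounded B s2" "R s2"
    using assms(2) by (auto simp: hoare_def)
  with 1 show "\<exists>t s'. exec (Seq c1 c2) s t s' \<and> t \<le> poly (time_bound (Seq c1 c2)) B \<and>
      bounded B s' \<and> R s'"
    by (intro exI[of _ "t1 + t2"] exI[of _ s2]) (auto intro: exec.Seq)
qed

lemma hoare_Cond:
  assumes "hoare B (\<lambda>s. P s \<and> expr_val e s \<noteq> 0) c1 Q" "hoare B (\<lambda>s. P s \<and> expr_val e s = 0) c2 Q"
  shows "hoare B P (Cond e c1 c2) Q"
  unfolding hoare_def
proof (intro allI impI)
  fix s assume s: "bounded B s" "P s"
  show "\<exists>t s'. exec (Cond e c1 c2) s t s' \<and> t \<le> poly (time_bound (Cond e c1 c2)) B \<and>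
      bounded B s' \<and> Q s'"
  proof (cases "expr_val e s = 0")
    case True
    then obtain t s' where "exec c2 s t s'" "t \<le> poly (time_bound c2) B" "bounded B s'" "Q s'"
      using assms(2) s by (auto simp: hoare_def)
    then show ?thesis
      using exec.Cond_False[OF True] test_cost_le[OF s(1), of e]
      by (intro exI[of _ "expr_cost e s + bit_length (expr_val e s) + t"] exI[of _ s']) auto
  next
    case False
    then obtain t s' where "exec c1 s t s'" "t \<le> poly (time_bound c1) B" "bounded B s'" "Q s'"
      using assms(1) s by (auto simp: hoare_def)
    then show ?thesis
      using exec.Cond_True[OF False] test_cost_le[OF s(1), of e]
      by (intro exI[of _ "expr_cost e s + bit_length (expr_val e s) + t"] exI[of _ s']) auto
  qed
qed

text \<open>The guard doubles as the variant: its value is the number of remaining iterations and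
  drops by exactly 1 each time.\<close>

lemma hoare_While:
  assumes body: "\<And>k. k < B \<Longrightarrow> hoare B (\<lambda>s. P s \<and> expr_val e s = Suc k) c (\<lambda>s. P s \<and> expr_val e s = k)"
    and post: "\<And>s. P s \<Longrightarrow> expr_val e s = 0 \<Longrightarrow> Q s"
  shows "hoare B (\<lambda>s. P s \<and> expr_val e s \<le> B) (While e c) Q"
proof -
  define T where "T = poly (cost_bound e + (val_bound e + 1) + time_bound c) B"
  have *: "\<exists>t s'. exec (While e c) s t s' \<and> t \<le> (k + 1) * T \<and> bounded B s' \<and> Q s'"
    if "bounded B s" "P s" "expr_val e s = k" "k \<le> B" for k s
    using that
  proof (induction k arbitrary: s)
    case 0
    then show ?case
      using exec.While_False[of e s c] test_cost_le[of B s e] post[of s]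
      unfolding T_def by (intro exI[of _ "expr_cost e s + bit_length (expr_val e s)"] exI[of _ s]) auto
  next
    case (Suc k)
    then obtain t1 s1 where 1: "exec c s t1 s1" "t1 \<le> poly (time_bound c) B" "bounded B s1" "P s1"
        "expr_val e s1 = k"
      using body[of k] by (auto simp: hoare_def)
    then obtain t2 s2 where 2: "exec (While e c) s1 t2 s2" "t2 \<le> (k + 1) * T" "bounded B s2" "Q s2"
      using Suc.IH[of s1] Suc.prems(4) by auto
    have "exec (While e c) s (expr_cost e s + bit_length (expr_val e s) + t1 + t2) s2"
      using 1 2 Suc by (intro exec.While_True) auto
    moreover have "expr_cost e s + bit_length (expr_val e s) + t1 \<le> T"
      using test_cost_le[OF Suc.prems(1), of e] 1(2) by (simp add: T_def)
    then have "expr_cost e s + bit_length (expr_val e s) + t1 + t2 \<le> (Suc k + 1) * T"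
      using 2(2) by simp
    ultimately show ?case using 2(3,4) by blast
  qed
  show ?thesis
    unfolding hoare_def
  proof (intro allI impI)
    fix s assume s: "bounded B s" "P s \<and> expr_val e s \<le> B"
    then obtain t s' where "exec (While e c) s t s'" "t \<le> (expr_val e s + 1) * T" "bounded B s'" "Q s'"
      using *[of s "expr_val e s"] by auto
    moreover have "(expr_val e s + 1) * T \<le> poly (time_bound (While e c)) B"
      using s mult_le_mono1[of "expr_val e s + 1" "B + 1" T]
      by (simp add: T_def)
    ultimately show "\<exists>t s'. exec (While e c) s t s' \<and> t \<le> poly (time_bound (While e c)) B \<and>
        bounded B s' \<and> Q s'"
      using order.trans by blast
  qed
qed

lemma hoare_conseq:
  assumes "hoare B P' c Q'" "\<And>s. P s \<Longrightarrow> P' s" "\<And>s. Q' s \<Longrightarrow> Q s"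
  shows "hoare B P c Q"
  using assms unfolding hoare_def by meson

lemma hoare_vacuous: "(\<And>s. \<not> P s) \<Longrightarrow> hoare B P c Q"
  by (simp add: hoare_def)

text \<open>Fixes the initial store, so that a postcondition can refer to it.\<close>

lemma hoare_pointwise:
  assumes "\<And>s0. P s0 \<Longrightarrow> bounded B s0 \<Longrightarrow> hoare B (\<lambda>s. s = s0) c Q"
  shows "hoare B P c Q"
  using assms unfolding hoare_def by blast

abbreviation var :: "string \<Rightarrow> expr" where
  "var x \<equiv> Cell x (Const 0)"

abbreviation assign_var :: "string \<Rightarrow> expr \<Rightarrow> prog" where
  "assign_var x e \<equiv> Assign x (Const 0) e"

definition set_var :: "string \<Rightarrow> nat \<Rightarrow> store \<Rightarrow> store" where
  "set_var x k s = s(x := (s x)(0 := k))"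

lemma set_var_apply [simp]:
  "set_var x k s x 0 = k" "y \<noteq> x \<Longrightarrow> set_var x k s y = s y"
  by (simp_all add: set_var_def)

definition for_below_n :: "string \<Rightarrow> prog \<Rightarrow> prog" where
  "for_below_n x c = Seq (assign_var x (Const 0))
     (While (Sub (var ''n'') (var x)) (Seq c (assign_var x (Add (var x) (Const 1)))))"

text \<open>The body has to establish the invariant for the store as it will be after the increment,
  hence \<open>set_var\<close> in its postcondition. The truncated difference of \<open>n\<close>
  and the counter serves as guard and variant.\<close>

lemma hoare_for_below_n:
  assumes n: "n \<le> B" and x: "x \<noteq> ''n''"
    and pre: "\<And>s. P s \<Longrightarrow> s ''n'' 0 = n \<and> I 0 (set_var x 0 s)"
    and body: "\<And>i. i < n \<Longrightarrow> hoare B (\<lambda>s. I i s \<and> s x 0 = i \<and> s ''n'' 0 = n) c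
        (\<lambda>s. I (Suc i) (set_var x (Suc i) s) \<and> s x 0 = i \<and> s ''n'' 0 = n)"
    and post: "\<And>s. I n s \<Longrightarrow> s ''n'' 0 = n \<Longrightarrow> Q s"
  shows "hoare B P (for_below_n x c) Q"
proof -
  let ?J = "\<lambda>s. s ''n'' 0 = n \<and> s x 0 \<le> n \<and> I (s x 0) s"
  let ?e = "Sub (var ''n'') (var x)"
  have "hoare B P (assign_var x (Const 0)) (\<lambda>s. ?J s \<and> expr_val ?e s \<le> B)"
    by (rule hoare_Assign) (use pre n x in \<open>auto simp: set_var_def\<close>)
  moreover have "hoare B (\<lambda>s. ?J s \<and> expr_val ?e s \<le> B)
      (While ?e (Seq c (assign_var x (Add (var x) (Const 1))))) Q"
  proof (rule hoare_While)
    fix k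
    show "hoare B (\<lambda>s. ?J s \<and> expr_val ?e s = Suc k) (Seq c (assign_var x (Add (var x) (Const 1))))
        (\<lambda>s. ?J s \<and> expr_val ?e s = k)"
    proof (rule hoare_pointwise)
      fix s0 assume s0: "?J s0 \<and> expr_val ?e s0 = Suc k"
      define i where "i = s0 x 0"
      have i: "i < n" "n - i = Suc k" using s0 by (auto simp: i_def)
      have "hoare B (\<lambda>s. s = s0) c (\<lambda>s. I (Suc i) (set_var x (Suc i) s) \<and> s x 0 = i \<and> s ''n'' 0 = n)"
        by (rule hoare_conseq[OF body[OF i(1)]]) (use s0 in \<open>auto simp: i_def\<close>)
      then show "hoare B (\<lambda>s. s = s0) (Seq c (assign_var x (Add (var x) (Const 1))))
          (\<lambda>s. ?J s \<and> expr_val ?e s = k)"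
        by (rule hoare_Seq, intro hoare_Assign) (use i n x in \<open>auto simp: set_var_def\<close>)
    qed
  next
    show "Q s" if "?J s" "expr_val ?e s = 0" for s
      using that post[of s] by (metis diff_is_0_eq expr_val.simps(1,2,4) le_antisym)
  qed
  ultimately show ?thesis
    unfolding for_below_n_def by (rule hoare_Seq)
qed

section \<open>The algorithm\<close>

abbreviation adjacency :: "string \<Rightarrow> string \<Rightarrow> expr" where
  "adjacency x y \<equiv> Cell ''adj'' (Add (Mul (var x) (var ''n'')) (var y))"

abbreviation cell_at :: "string \<Rightarrow> string \<Rightarrow> expr" where
  "cell_at a x \<equiv> Cell a (var x)"

text \<open>One of the truncated differences vanishes, so this is |a - b|, used as a test for
  inequality.\<close>

abbreviation distance :: "expr \<Rightarrow> expr \<Rightarrow> expr" where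
  "distance e1 e2 \<equiv> Add (Sub e1 e2) (Sub e2 e1)"

definition init_tables :: prog where
  "init_tables = for_below_n ''v''
     (Seq (Assign ''sz'' (var ''v'') (Const 1)) (Assign ''F'' (var ''v'') (var ''p'')))"

text \<open>Products act as conjunctions: the condition holds iff \<open>w\<close> is unmerged,
  differs from \<open>u\<close> and \<open>v\<close>, and is adjacent to exactly one of
  them.\<close>

definition twin_test :: prog where
  "twin_test = Seq (assign_var ''bad'' (Const 0))
     (for_below_n ''w''
       (Cond (Mul (Mul (cell_at ''sz'' ''w'') (distance (adjacency ''u'' ''w'') (adjacency ''v'' ''w'')))
                (Mul (distance (var ''w'') (var ''u'')) (distance (var ''w'') (var ''v''))))
         (assign_var ''bad'' (Const 1))
         Skip))"

text \<open>The sum \<open>a + (b - a)\<close> with truncated subtraction is the maximum of \<open>a\<close> and \<open>b\<close>.\<close>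

definition merge :: prog where
  "merge = Seq
     (Cond (adjacency ''u'' ''v'')
       (let a = Sub (cell_at ''F'' ''v'') (Mul (var ''q'') (cell_at ''sz'' ''u''));
            b = Sub (cell_at ''F'' ''u'') (Mul (var ''q'') (cell_at ''sz'' ''v''))
        in Assign ''F'' (var ''v'') (Add a (Sub b a)))
       (Assign ''F'' (var ''v'') (Add (cell_at ''F'' ''u'') (cell_at ''F'' ''v''))))
     (Seq (Assign ''sz'' (var ''v'') (Add (cell_at ''sz'' ''u'') (cell_at ''sz'' ''v'')))
       (Assign ''sz'' (var ''u'') (Const 0)))"

definition merge_if_twins :: prog where
  "merge_if_twins =
     Cond (Mul (Mul (cell_at ''sz'' ''u'') (cell_at ''sz'' ''v'')) (Sub (var ''u'') (var ''v'')))
       (Seq twin_test (Cond (var ''bad'') Skip merge))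
       Skip"

definition compute_gain :: prog where
  "compute_gain = Seq init_tables
     (for_below_n ''r'' (for_below_n ''u'' (for_below_n ''v'' merge_if_twins)))"

text \<open>Nested conditions accept a pair iff the gain is 0, \<open>q \<le> p\<close>, and q / (p
  + q) < num / den after cross multiplication.\<close>

definition update_result :: prog where
  "update_result =
     Cond (Cell ''F'' (Const 0)) Skip
       (Cond (Sub (var ''q'') (var ''p'')) Skip
         (Cond (Sub (Mul (var ''num'') (Add (var ''p'') (var ''q''))) (Mul (var ''q'') (var ''den'')))
           (Seq (assign_var ''num'' (var ''q'')) (assign_var ''den'' (Add (var ''p'') (var ''q''))))
           Skip))"

text \<open>The counters start at 0, hence the shift by 1. The initial 1/1 is the answer if no pair
  is accepted.\<close>

definition capacity_prog :: prog where
  "capacity_prog =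
     Seq (assign_var ''num'' (Const 1)) (Seq (assign_var ''den'' (Const 1))
       (for_below_n ''i'' (for_below_n ''j''
         (Seq (assign_var ''p'' (Add (var ''i'') (Const 1)))
           (Seq (assign_var ''q'' (Add (var ''j'') (Const 1)))
             (Seq compute_gain update_result))))))"

definition same_except :: "string set \<Rightarrow> store \<Rightarrow> store \<Rightarrow> bool" where
  "same_except X s0 s \<longleftrightarrow> (\<forall>y. y \<notin> X \<longrightarrow> s y = s0 y)"

lemma same_exceptD: "same_except X s0 s \<Longrightarrow> y \<notin> X \<Longrightarrow> s y = s0 y"
  by (simp add: same_except_def)

lemma same_except_refl [simp]: "same_except X s s"
  by (simp add: same_except_def)

lemma same_except_trans:
  "same_except X s0 s1 \<Longrightarrow> same_except Y s1 s2 \<Longrightarrow> Y \<subseteq> X \<Longrightarrow> same_except X s0 s2"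
  unfolding same_except_def by (metis subsetD)

lemma same_except_set_var [simp]: "x \<in> X \<Longrightarrow> same_except X s0 (set_var x k s) \<longleftrightarrow> same_except X s0 s"
  by (auto simp: same_except_def set_var_def)

lemma same_except_update [simp]: "x \<in> X \<Longrightarrow> same_except X s0 (s(x := a)) \<longleftrightarrow> same_except X s0 s"
  by (auto simp: same_except_def)

abbreviation work_arrays :: "string set" where
  "work_arrays \<equiv> {''sz'', ''F'', ''u'', ''v'', ''w'', ''r'', ''bad''}"

text \<open>The gain is written before the sizes because the join formula reads the old
  sizes.\<close>

lemma hoare_merge:
  assumes uv: "s0 ''u'' 0 = u" "s0 ''v'' 0 = v" "u \<noteq> v" and nq: "s0 ''n'' 0 = n" "s0 ''q'' 0 = q"
    and f: "f = (if s0 ''adj'' (u * n + v) \<noteq> 0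
        then max (s0 ''F'' v - q * s0 ''sz'' u) (s0 ''F'' u - q * s0 ''sz'' v)
        else s0 ''F'' u + s0 ''F'' v)"
    and B: "f \<le> B" "s0 ''sz'' u + s0 ''sz'' v \<le> B"
  shows "hoare B (\<lambda>s. s = s0) merge (\<lambda>s. s = s0(''F'' := (s0 ''F'')(v := f),
    ''sz'' := (s0 ''sz'')(v := s0 ''sz'' u + s0 ''sz'' v, u := 0)))"
proof -
  let ?s1 = "s0(''F'' := (s0 ''F'')(v := f))"
  let ?s2 = "?s1(''sz'' := (s0 ''sz'')(v := s0 ''sz'' u + s0 ''sz'' v))"
  let ?a = "Sub (cell_at ''F'' ''v'') (Mul (var ''q'') (cell_at ''sz'' ''u''))"
  let ?b = "Sub (cell_at ''F'' ''u'') (Mul (var ''q'') (cell_at ''sz'' ''v''))"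
  have max: "a + (b - a) = max a b" for a b :: nat by simp
  have val: "expr_val (Add ?a (Sub ?b ?a)) s0 = f" if "s0 ''adj'' (u * n + v) \<noteq> 0"
    unfolding expr_val.simps uv nq max using f that by simp
  show ?thesis
    unfolding merge_def Let_def
  proof (rule hoare_Seq[where Q = "\<lambda>s. s = ?s1"], rule hoare_Cond)
    show "hoare B (\<lambda>s. s = ?s1)
      (Seq (Assign ''sz'' (var ''v'') (Add (cell_at ''sz'' ''u'') (cell_at ''sz'' ''v'')))
        (Assign ''sz'' (var ''u'') (Const 0)))
      (\<lambda>s. s = s0(''F'' := (s0 ''F'')(v := f),
        ''sz'' := (s0 ''sz'')(v := s0 ''sz'' u + s0 ''sz'' v, u := 0)))"
      by (rule hoare_Seq[where Q = "\<lambda>s. s = ?s2"]; rule hoare_Assign) (use uv B in auto)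
    show "hoare B (\<lambda>s. s = s0 \<and> expr_val (adjacency ''u'' ''v'') s \<noteq> 0)
      (Assign ''F'' (var ''v'') (Add ?a (Sub ?b ?a))) (\<lambda>s. s = ?s1)"
    proof (rule hoare_Assign)
      fix s assume s: "s = s0 \<and> expr_val (adjacency ''u'' ''v'') s \<noteq> 0"
      then have "s0 ''adj'' (u * n + v) \<noteq> 0" and "s = s0" using uv nq by auto
      then have "expr_val (Add ?a (Sub ?b ?a)) s = f" using val by blast
      then show "expr_val (Add ?a (Sub ?b ?a)) s \<le> B \<and>
          s(''F'' := (s ''F'')(expr_val (var ''v'') s := expr_val (Add ?a (Sub ?b ?a)) s)) = ?s1"
        using s uv B by (simp del: expr_val.simps(3))
    qed
    show "hoare B (\<lambda>s. s = s0 \<and> expr_val (adjacency ''u'' ''v'') s = 0)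
      (Assign ''F'' (var ''v'') (Add (cell_at ''F'' ''u'') (cell_at ''F'' ''v''))) (\<lambda>s. s = ?s1)"
      by (rule hoare_Assign) (use uv nq f B in auto)
  qed
qed

section \<open>Correctness of the gain computation for one pair\<close>

context cograph_on
begin

text \<open>Each round removes at least one active vertex until a single one is left, hence the
  bound \<open>max 1 (n - r)\<close>.\<close>

definition round_inv :: "nat \<Rightarrow> nat \<Rightarrow> nat \<Rightarrow> (nat \<Rightarrow> nat) \<Rightarrow> (nat \<Rightarrow> nat) \<Rightarrow> bool" where
  "round_inv p q r sz F \<longleftrightarrow>
     gain_tables p q n G sz F \<and> sz 0 \<noteq> 0 \<and> card (active n sz) \<le> max 1 (n - r)"

text \<open>
  Inside round \<open>r\<close>, either a merge has already happened or no pair inspected so far is a pair of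
  twins; a complete round therefore decreases the number of active vertices.
\<close>

definition sweep_inv :: "nat \<Rightarrow> nat \<Rightarrow> nat \<Rightarrow> nat \<Rightarrow> nat \<Rightarrow> (nat \<Rightarrow> nat) \<Rightarrow> (nat \<Rightarrow> nat) \<Rightarrow> bool" where
  "sweep_inv p q r u v sz F \<longleftrightarrow> round_inv p q r sz F \<and>
     (card (active n sz) \<le> max 1 (n - Suc r) \<or>
      (\<forall>a b. b < a \<and> a < n \<and> (a < u \<or> a = u \<and> b < v) \<longrightarrow> \<not> twins n G sz a b))"

lemma sweep_inv_start: "round_inv p q r sz F \<Longrightarrow> sweep_inv p q r 0 0 sz F"
  by (simp add: sweep_inv_def)

lemma sweep_inv_skip:
  "sweep_inv p q r u v sz F \<Longrightarrow> \<not> (v < u \<and> twins n G sz u v) \<Longrightarrow> sweep_inv p q r u (Suc v) sz F"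
  by (auto simp: sweep_inv_def less_Suc_eq)

text \<open>The merge secures the first alternative for the rest of the round. Vertex 0 stays active
  because \<open>u > v\<close> excludes \<open>u = 0\<close>.\<close>

lemma sweep_inv_merge:
  assumes "sweep_inv p q r u v sz F" "v < u" "u < n" "twins n G sz u v"
    and "f = (if (u, v) \<in> parcs G then max (F v - q * sz u) (F u - q * sz v) else F u + F v)"
  shows "sweep_inv p q r u (Suc v) (sz(v := sz u + sz v, u := 0)) (F(v := f))"
proof -
  have "card (active n (sz(v := sz u + sz v, u := 0))) \<le> max 1 (n - r) - 1"
    unfolding card_active_merge[OF assms(2-4)]
    using assms(1) by (intro diff_le_mono) (simp add: sweep_inv_def round_inv_def)
  moreover have "gain_tables p q n G (sz(v := sz u + sz v, u := 0)) (F(v := f))"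
    using assms(1) by (intro gain_tables_merge assms) (simp add: sweep_inv_def round_inv_def)
  moreover have "(sz(v := sz u + sz v, u := 0)) 0 \<noteq> 0"
    using assms(1,2) by (simp add: sweep_inv_def round_inv_def)
  ultimately show ?thesis
    unfolding sweep_inv_def round_inv_def by linarith
qed

lemma sweep_inv_next_row: "sweep_inv p q r u n sz F \<Longrightarrow> sweep_inv p q r (Suc u) 0 sz F"
  by (auto simp: sweep_inv_def less_Suc_eq)

text \<open>If at least two vertices were active and no merge had happened, all pairs would have
  been rejected, contradicting the existence of twins in a cograph.\<close>

lemma sweep_inv_end:
  assumes "sweep_inv p q r n 0 sz F"
  shows "round_inv p q (Suc r) sz F"
proof (cases "card (active n sz) \<le> max 1 (n - Suc r)")
  case False
  then have "2 \<le> card (active n sz)" by simp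
  then obtain u v where "v < u" "twins n G sz u v" using ex_twins by blast
  moreover from this have "u < n" by (simp add: twins_def twins_in_def active_def)
  ultimately show ?thesis using assms False by (auto simp: sweep_inv_def)
qed (use assms in \<open>simp add: sweep_inv_def round_inv_def\<close>)

definition holds_graph :: "store \<Rightarrow> bool" where
  "holds_graph s \<longleftrightarrow> s ''n'' 0 = n \<and>
     (\<forall>u<n. \<forall>v<n. s ''adj'' (u * n + v) = (if (u, v) \<in> parcs G then 1 else 0))"

lemma holds_graph_cong: "s ''n'' = s0 ''n'' \<Longrightarrow> s ''adj'' = s0 ''adj'' \<Longrightarrow> holds_graph s \<longleftrightarrow> holds_graph s0"
  by (simp add: holds_graph_def)

text \<open>Large enough for the gains, at most n^2, for the denominator p + q \<le> 2 n, and for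
  the loop counters.\<close>

definition B :: nat where
  "B = (n + 1)\<^sup>2"

lemma le_B: "n \<le> B" "1 \<le> B" "n * n \<le> B" "n + n \<le> B"
  by (simp_all add: B_def power2_eq_square)

lemma hoare_twin_test:
  assumes G: "holds_graph s0" and uv: "s0 ''u'' 0 = u" "s0 ''v'' 0 = v" "u < n" "v < u"
    and act: "s0 ''sz'' u \<noteq> 0" "s0 ''sz'' v \<noteq> 0"
  shows "hoare B (\<lambda>s. s = s0) twin_test
    (\<lambda>s. same_except {''bad'', ''w''} s0 s \<and> (s ''bad'' 0 = 0 \<longleftrightarrow> twins n G (s0 ''sz'') u v))"
proof -
  let ?ok = "\<lambda>w. s0 ''sz'' w \<noteq> 0 \<longrightarrow> w \<noteq> u \<longrightarrow> w \<noteq> v \<longrightarrow> ((u, w) \<in> parcs G \<longleftrightarrow> (v, w) \<in> parcs G)"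
  let ?I = "\<lambda>i s. same_except {''bad'', ''w''} s0 s \<and> (s ''bad'' 0 = 0 \<longleftrightarrow> (\<forall>w<i. ?ok w))"
  have twins: "twins n G (s0 ''sz'') u v \<longleftrightarrow> (\<forall>w<n. ?ok w)"
    using uv act by (auto simp: twins_def twins_in_def active_def)
  let ?test = "Mul (Mul (cell_at ''sz'' ''w'') (distance (adjacency ''u'' ''w'') (adjacency ''v'' ''w'')))
                (Mul (distance (var ''w'') (var ''u'')) (distance (var ''w'') (var ''v'')))"
  show ?thesis
    unfolding twin_test_def
  proof (rule hoare_Seq)
    show "hoare B (\<lambda>s. s = s0) (assign_var ''bad'' (Const 0))
        (\<lambda>s. same_except {''bad'', ''w''} s0 s \<and> s ''bad'' 0 = 0)"
      by (rule hoare_Assign) simp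
    show "hoare B (\<lambda>s. same_except {''bad'', ''w''} s0 s \<and> s ''bad'' 0 = 0)
      (for_below_n ''w'' (Cond ?test (assign_var ''bad'' (Const 1)) Skip))
      (\<lambda>s. same_except {''bad'', ''w''} s0 s \<and> (s ''bad'' 0 = 0 \<longleftrightarrow> twins n G (s0 ''sz'') u v))"
    proof (rule hoare_for_below_n[where I = ?I, OF le_B(1)])
      fix i assume i: "i < n"
      have test: "expr_val ?test s = 0 \<longleftrightarrow> ?ok i"
        if "same_except {''bad'', ''w''} s0 s" "s ''w'' 0 = i" for s
      proof -
        have "s y = s0 y" if "y \<noteq> ''bad''" "y \<noteq> ''w''" for y
          using same_exceptD[OF \<open>same_except _ s0 s\<close>] that by simp
        then have "s ''sz'' = s0 ''sz''" "s ''adj'' = s0 ''adj''" "s ''n'' = s0 ''n''"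
          "s ''u'' = s0 ''u''" "s ''v'' = s0 ''v''"
          by simp_all
        then show ?thesis
          using that(2) G uv i by (auto simp: holds_graph_def)
      qed
      show "hoare B (\<lambda>s. ?I i s \<and> s ''w'' 0 = i \<and> s ''n'' 0 = n)
          (Cond ?test (assign_var ''bad'' (Const 1)) Skip)
          (\<lambda>s. ?I (Suc i) (set_var ''w'' (Suc i) s) \<and> s ''w'' 0 = i \<and> s ''n'' 0 = n)"
      proof (rule hoare_Cond)
        show "hoare B (\<lambda>s. (?I i s \<and> s ''w'' 0 = i \<and> s ''n'' 0 = n) \<and> expr_val ?test s \<noteq> 0)
          (assign_var ''bad'' (Const 1))
          (\<lambda>s. ?I (Suc i) (set_var ''w'' (Suc i) s) \<and> s ''w'' 0 = i \<and> s ''n'' 0 = n)"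
        proof (rule hoare_Assign)
          fix s assume s: "(?I i s \<and> s ''w'' 0 = i \<and> s ''n'' 0 = n) \<and> expr_val ?test s \<noteq> 0"
          have "same_except {''bad'', ''w''} s0 s" "s ''w'' 0 = i" using s by simp_all
          note test = test[OF this]
          have "\<not> ?ok i" using s[THEN conjunct2] unfolding test .
          then have "\<not> (\<forall>w<Suc i. ?ok w)" by blast
          with s le_B(2) show "expr_val (Const 1) s \<le> B \<and>
              (?I (Suc i) (set_var ''w'' (Suc i) (s(''bad'' := (s ''bad'')(expr_val (Const 0) s := expr_val (Const 1) s))))
              \<and> (s(''bad'' := (s ''bad'')(expr_val (Const 0) s := expr_val (Const 1) s))) ''w'' 0 = i
              \<and> (s(''bad'' := (s ''bad'')(expr_val (Const 0) s := expr_val (Const 1) s))) ''n'' 0 = n)"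
            by simp
        qed
        show "hoare B (\<lambda>s. (?I i s \<and> s ''w'' 0 = i \<and> s ''n'' 0 = n) \<and> expr_val ?test s = 0) Skip
          (\<lambda>s. ?I (Suc i) (set_var ''w'' (Suc i) s) \<and> s ''w'' 0 = i \<and> s ''n'' 0 = n)"
        proof (rule hoare_Skip)
          fix s assume s: "(?I i s \<and> s ''w'' 0 = i \<and> s ''n'' 0 = n) \<and> expr_val ?test s = 0"
          have "same_except {''bad'', ''w''} s0 s" "s ''w'' 0 = i" using s by simp_all
          note test = test[OF this]
          have "?ok i" using s[THEN conjunct2] unfolding test .
          then have "(\<forall>w<Suc i. ?ok w) \<longleftrightarrow> (\<forall>w<i. ?ok w)" by (metis less_Suc_eq)
          with s show "?I (Suc i) (set_var ''w'' (Suc i) s) \<and> s ''w'' 0 = i \<and> s ''n'' 0 = n"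
            by simp
        qed
      qed
    qed (use G twins in \<open>auto simp: holds_graph_def dest: same_exceptD[where y = "''n''"]\<close>)
  qed
qed

lemma hoare_merge_if_twins:
  assumes G: "holds_graph s0" and q: "s0 ''q'' 0 = q" and p: "p \<le> n" and uv: "u < n" "v < n"
  shows "hoare B
    (\<lambda>s. same_except work_arrays s0 s \<and> s ''r'' 0 = r \<and> s ''u'' 0 = u \<and> s ''v'' 0 = v \<and>
       sweep_inv p q r u v (s ''sz'') (s ''F''))
    merge_if_twins
    (\<lambda>s. same_except work_arrays s0 s \<and> s ''r'' 0 = r \<and> s ''u'' 0 = u \<and> s ''v'' 0 = v \<and>
       sweep_inv p q r u (Suc v) (s ''sz'') (s ''F''))"
    (is "hoare B ?P merge_if_twins ?Q")
proof (rule hoare_pointwise)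
  fix s1 assume s1: "?P s1"
  have same1: "same_except work_arrays s0 s1" using s1 by simp
  have "s1 ''n'' = s0 ''n''" "s1 ''adj'' = s0 ''adj''" "s1 ''q'' = s0 ''q''"
    using same1 by (auto intro!: same_exceptD)
  then have G1: "holds_graph s1" "s1 ''q'' 0 = q" using G q holds_graph_cong[of s1 s0] by auto
  let ?guard = "Mul (Mul (cell_at ''sz'' ''u'') (cell_at ''sz'' ''v'')) (Sub (var ''u'') (var ''v''))"
  show "hoare B (\<lambda>s. s = s1) merge_if_twins ?Q"
    unfolding merge_if_twins_def
  proof (rule hoare_Cond)
    have Q: "?Q s1" if "expr_val ?guard s1 = 0"
    proof -
      have "\<not> (v < u \<and> twins n G (s1 ''sz'') u v)"
        using that s1 by (auto simp: twins_def twins_in_def active_def)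
      then show ?thesis using s1 sweep_inv_skip by blast
    qed
    show "hoare B (\<lambda>s. s = s1 \<and> expr_val ?guard s = 0) Skip ?Q"
    proof (rule hoare_Skip)
      fix s assume s: "s = s1 \<and> expr_val ?guard s = 0"
      have "s = s1" using s by (rule conjunct1)
      from Q[OF s[THEN conjunct2, unfolded this]] show "?Q s" unfolding \<open>s = s1\<close> .
    qed
    show "hoare B (\<lambda>s. s = s1 \<and> expr_val ?guard s \<noteq> 0) (Seq twin_test (Cond (var ''bad'') Skip merge)) ?Q"
    proof (cases "expr_val ?guard s1 = 0")
      case True
      then show ?thesis by (intro hoare_vacuous) simp
    next
      case False
      then have act: "v < u" "s1 ''sz'' u \<noteq> 0" "s1 ''sz'' v \<noteq> 0" using s1 by auto
      let ?M = "\<lambda>s. same_except {''bad'', ''w''} s1 s \<and> (s ''bad'' 0 = 0 \<longleftrightarrow> twins n G (s1 ''sz'') u v)"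
      have "hoare B (\<lambda>s. s = s1) twin_test ?M"
        using G1 s1 uv act by (intro hoare_twin_test) auto
      moreover have "hoare B ?M (Cond (var ''bad'') Skip merge) ?Q"
      proof (rule hoare_pointwise)
        fix s2 assume s2: "?M s2"
        have eq: "s2 ''r'' = s1 ''r''" "s2 ''u'' = s1 ''u''" "s2 ''v'' = s1 ''v''" "s2 ''sz'' = s1 ''sz''"
            "s2 ''F'' = s1 ''F''" "s2 ''n'' = s1 ''n''" "s2 ''adj'' = s1 ''adj''" "s2 ''q'' = s1 ''q''"
          using s2 by (auto intro!: same_exceptD)
        have same2: "same_except work_arrays s0 s2"
          using same1 s2 by (blast intro: same_except_trans)
        have inv: "sweep_inv p q r u v (s2 ''sz'') (s2 ''F'')" using s1 eq by simp
        show "hoare B (\<lambda>s. s = s2) (Cond (var ''bad'') Skip merge) ?Q"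
        proof (rule hoare_Cond)
          show "hoare B (\<lambda>s. s = s2 \<and> expr_val (var ''bad'') s \<noteq> 0) Skip ?Q"
          proof (rule hoare_Skip)
            fix s assume s: "s = s2 \<and> expr_val (var ''bad'') s \<noteq> 0"
            then have "\<not> twins n G (s2 ''sz'') u v" using s2 eq by auto
            then have "sweep_inv p q r u (Suc v) (s2 ''sz'') (s2 ''F'')"
              using inv sweep_inv_skip by blast
            then show "?Q s" using s same2 s1 eq by simp
          qed
          show "hoare B (\<lambda>s. s = s2 \<and> expr_val (var ''bad'') s = 0) merge ?Q"
          proof (cases "s2 ''bad'' 0 = 0")
            case False
            then show ?thesis by (intro hoare_vacuous) simp
          next
            case True
            define f where "f = (if (u, v) \<in> parcs G
              then max (s2 ''F'' v - q * s2 ''sz'' u) (s2 ''F'' u - q * s2 ''sz'' v)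
              else s2 ''F'' u + s2 ''F'' v)"
            let ?sz = "(s2 ''sz'')(v := s2 ''sz'' u + s2 ''sz'' v, u := 0)" and ?F = "(s2 ''F'')(v := f)"
            have inv': "sweep_inv p q r u (Suc v) ?sz ?F"
              using True s2 eq inv act uv f_def by (intro sweep_inv_merge) auto
            \<comment> \<open>The values about to be written are bounded through the invariant for
              the tables after the merge.\<close>
            then have "gain_tables p q n G ?sz ?F" by (simp add: sweep_inv_def round_inv_def)
            from gain_tables_bounds[OF this uv(2)] act
            have "f \<le> p * n" "s2 ''sz'' u + s2 ''sz'' v \<le> n" by (auto simp: eq)
            moreover have "p * n \<le> B" using p le_B(3) by (meson le_trans mult_le_mono1)
            ultimately have le: "f \<le> B" "s2 ''sz'' u + s2 ''sz'' v \<le> B" using le_B(1) by auto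
            have "hoare B (\<lambda>s. s = s2) merge (\<lambda>s. s = s2(''F'' := ?F, ''sz'' := ?sz))"
            proof (rule hoare_merge[where q = q])
              show "s2 ''n'' 0 = n" using G1 eq by (simp add: holds_graph_def)
              show "f = (if s2 ''adj'' (u * n + v) \<noteq> 0
                then max (s2 ''F'' v - q * s2 ''sz'' u) (s2 ''F'' u - q * s2 ''sz'' v)
                else s2 ''F'' u + s2 ''F'' v)"
                using G1 eq uv by (simp add: f_def holds_graph_def)
            qed (use s1 eq act G1 le in auto)
            then show ?thesis
              by (rule hoare_conseq) (use inv' same2 s1 eq in auto)
          qed
        qed
      qed
      ultimately have "hoare B (\<lambda>s. s = s1) (Seq twin_test (Cond (var ''bad'') Skip merge)) ?Q"
        by (rule hoare_Seq)
      then show ?thesis by (rule hoare_conseq) auto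
    qed
  qed
qed

lemma hoare_init_tables:
  assumes G: "holds_graph s0" and p: "s0 ''p'' 0 = p" "p \<le> n"
  shows "hoare B (\<lambda>s. s = s0) init_tables
    (\<lambda>s. same_except work_arrays s0 s \<and> round_inv p q 0 (s ''sz'') (s ''F''))"
proof -
  let ?I = "\<lambda>i s. same_except work_arrays s0 s \<and> (\<forall>w<i. s ''sz'' w = 1 \<and> s ''F'' w = p)"
  show ?thesis
    unfolding init_tables_def
  proof (rule hoare_for_below_n[where I = ?I, OF le_B(1)])
    fix i assume i: "i < n"
    let ?J = "\<lambda>s. same_except work_arrays s0 s \<and> (\<forall>w<i. s ''sz'' w = 1 \<and> s ''F'' w = p) \<and>
      s ''v'' 0 = i \<and> s ''n'' 0 = n \<and> s ''sz'' i = 1"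
    show "hoare B (\<lambda>s. ?I i s \<and> s ''v'' 0 = i \<and> s ''n'' 0 = n)
        (Seq (Assign ''sz'' (var ''v'') (Const 1)) (Assign ''F'' (var ''v'') (var ''p'')))
        (\<lambda>s. ?I (Suc i) (set_var ''v'' (Suc i) s) \<and> s ''v'' 0 = i \<and> s ''n'' 0 = n)"
    proof (rule hoare_Seq)
      show "hoare B (\<lambda>s. ?I i s \<and> s ''v'' 0 = i \<and> s ''n'' 0 = n)
          (Assign ''sz'' (var ''v'') (Const 1)) ?J"
        by (rule hoare_Assign) (use le_B in auto)
      show "hoare B ?J (Assign ''F'' (var ''v'') (var ''p''))
          (\<lambda>s. ?I (Suc i) (set_var ''v'' (Suc i) s) \<and> s ''v'' 0 = i \<and> s ''n'' 0 = n)"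
      proof (rule hoare_Assign)
        fix s assume s: "?J s"
        then have "s ''p'' = s0 ''p''" by (auto intro!: same_exceptD)
        with s p le_B(1) show "expr_val (var ''p'') s \<le> B \<and>
            ?I (Suc i) (set_var ''v'' (Suc i) (s(''F'' := (s ''F'')(expr_val (var ''v'') s := expr_val (var ''p'') s)))) \<and>
            (s(''F'' := (s ''F'')(expr_val (var ''v'') s := expr_val (var ''p'') s))) ''v'' 0 = i \<and>
            (s(''F'' := (s ''F'')(expr_val (var ''v'') s := expr_val (var ''p'') s))) ''n'' 0 = n"
          by (auto simp: less_Suc_eq)
      qed
    qed
  next
    fix s assume s: "?I n s"
    then have "gain_tables p q n G (s ''sz'') (s ''F'')" "s ''sz'' 0 \<noteq> 0"
      using n by (auto intro: gain_tables_initial)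
    moreover have "card (active n (s ''sz'')) \<le> n"
      using card_mono[of "{..<n}" "active n (s ''sz'')"] by (auto simp: active_def)
    ultimately show "same_except work_arrays s0 s \<and> round_inv p q 0 (s ''sz'') (s ''F'')"
      using s by (simp add: round_inv_def)
  qed (use G in \<open>auto simp: holds_graph_def\<close>)
qed

lemma hoare_compute_gain:
  assumes G: "holds_graph s0" and pq: "s0 ''p'' 0 = p" "s0 ''q'' 0 = q" "p \<le> n"
  shows "hoare B (\<lambda>s. s = s0) compute_gain
    (\<lambda>s. same_except work_arrays s0 s \<and> (s ''F'' 0 = 0 \<longleftrightarrow> expanding p q G))"
proof -
  have n_eq: "s ''n'' 0 = n" if "same_except work_arrays s0 s" for s
    using same_exceptD[OF that, of "''n''"] G by (simp add: holds_graph_def)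
  let ?R = "\<lambda>r s. same_except work_arrays s0 s \<and> round_inv p q r (s ''sz'') (s ''F'')"
  let ?U = "\<lambda>r u s. same_except work_arrays s0 s \<and> s ''r'' 0 = r \<and> sweep_inv p q r u 0 (s ''sz'') (s ''F'')"
  let ?V = "\<lambda>r u v s. same_except work_arrays s0 s \<and> s ''r'' 0 = r \<and> s ''u'' 0 = u \<and>
    sweep_inv p q r u v (s ''sz'') (s ''F'')"
  have V: "hoare B (\<lambda>s. ?V r u 0 s) (for_below_n ''v'' merge_if_twins) (\<lambda>s. ?V r u n s)" if "u < n" for r u
  proof (rule hoare_for_below_n[where I = "?V r u", OF le_B(1)])
    fix v assume v: "v < n"
    show "hoare B (\<lambda>s. ?V r u v s \<and> s ''v'' 0 = v \<and> s ''n'' 0 = n) merge_if_twins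
       (\<lambda>s. ?V r u (Suc v) (set_var ''v'' (Suc v) s) \<and> s ''v'' 0 = v \<and> s ''n'' 0 = n)"
      by (rule hoare_conseq[OF hoare_merge_if_twins[OF G pq(2,3) that v, of r]]) (use n_eq in auto)
  qed (use n_eq in auto)
  have U: "hoare B (\<lambda>s. ?U r 0 s) (for_below_n ''u'' (for_below_n ''v'' merge_if_twins)) (\<lambda>s. ?U r n s)" for r
  proof (rule hoare_for_below_n[where I = "?U r", OF le_B(1)])
    fix u assume u: "u < n"
    show "hoare B (\<lambda>s. ?U r u s \<and> s ''u'' 0 = u \<and> s ''n'' 0 = n) (for_below_n ''v'' merge_if_twins)
       (\<lambda>s. ?U r (Suc u) (set_var ''u'' (Suc u) s) \<and> s ''u'' 0 = u \<and> s ''n'' 0 = n)"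
      by (rule hoare_conseq[OF V[OF u, of r]]) (use n_eq sweep_inv_next_row in auto)
  qed (use n_eq in auto)
  have "hoare B (?R 0) (for_below_n ''r'' (for_below_n ''u'' (for_below_n ''v'' merge_if_twins))) (?R n)"
  proof (rule hoare_for_below_n[where I = ?R, OF le_B(1)])
    fix r
    show "hoare B (\<lambda>s. ?R r s \<and> s ''r'' 0 = r \<and> s ''n'' 0 = n)
        (for_below_n ''u'' (for_below_n ''v'' merge_if_twins))
       (\<lambda>s. ?R (Suc r) (set_var ''r'' (Suc r) s) \<and> s ''r'' 0 = r \<and> s ''n'' 0 = n)"
      by (rule hoare_conseq[OF U[of r]]) (use n_eq sweep_inv_start sweep_inv_end in auto)
  qed (use n_eq in auto)
  then have "hoare B (\<lambda>s. s = s0) compute_gain (?R n)"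
    unfolding compute_gain_def using hoare_Seq[OF hoare_init_tables[OF G pq(1,3)]] by blast
  then show ?thesis
  proof (rule hoare_conseq)
    fix s assume s: "?R n s"
    then have "card (active n (s ''sz'')) \<le> 1" by (simp add: round_inv_def)
    then have "s ''F'' 0 = 0 \<longleftrightarrow> expanding p q G"
      using s by (intro gain_tables_final[of p q "s ''sz''" "s ''F''"]) (simp_all add: round_inv_def)
    then show "same_except work_arrays s0 s \<and> (s ''F'' 0 = 0 \<longleftrightarrow> expanding p q G)"
      using s by simp
  qed
qed

section \<open>The search over all pairs\<close>

text \<open>The pairs are tested in lexicographic order: those with \<open>p \<le> i\<close>, and
  those with \<open>p = Suc i\<close> and \<open>q \<le> j\<close>, are done.\<close>

definition result_inv :: "nat \<Rightarrow> nat \<Rightarrow> nat \<Rightarrow> nat \<Rightarrow> bool" where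
  "result_inv i j a b \<longleftrightarrow>
     ((a, b) = (1, 1) \<or> (\<exists>p q. 0 < q \<and> q \<le> p \<and> expanding p q G \<and> a = q \<and> b = p + q)) \<and>
     (\<forall>p q. 0 < q \<longrightarrow> q \<le> p \<longrightarrow> p \<le> n \<longrightarrow> p \<le> i \<or> p = Suc i \<and> q \<le> j \<longrightarrow> expanding p q G \<longrightarrow>
        a * (p + q) \<le> q * b)"

lemma result_invD:
  assumes "result_inv i j a b"
  shows "(a, b) = (1, 1) \<or> (\<exists>p q. 0 < q \<and> q \<le> p \<and> expanding p q G \<and> a = q \<and> b = p + q)"
    and "0 < q \<Longrightarrow> q \<le> p \<Longrightarrow> p \<le> n \<Longrightarrow> p \<le> i \<or> p = Suc i \<and> q \<le> j \<Longrightarrow> expanding p q G \<Longrightarrow>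
      a * (p + q) \<le> q * b"
  using assms unfolding result_inv_def by blast+

lemma result_inv_initial: "result_inv 0 0 1 1"
  by (auto simp: result_inv_def)

lemma result_inv_next_row:
  assumes "result_inv i n a b"
  shows "result_inv (Suc i) 0 a b"
  unfolding result_inv_def
proof (intro conjI allI impI)
  fix p q assume *: "0 < q" "q \<le> p" "p \<le> n" "p \<le> Suc i \<or> p = Suc (Suc i) \<and> q \<le> 0" "expanding p q G"
  \<comment> \<open>A row counts as complete at \<open>n\<close> because
    \<open>q \<le> p \<le> n\<close>; the alternative \<open>q \<le> 0\<close> is excluded.\<close>
  then have "p \<le> i \<or> p = Suc i \<and> q \<le> n" by auto
  with * show "a * (p + q) \<le> q * b" by (intro result_invD(2)[OF assms])
qed (fact result_invD(1)[OF assms])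

lemma result_inv_step:
  assumes "(a, b) = (1, 1) \<or> (\<exists>p q. 0 < q \<and> q \<le> p \<and> expanding p q G \<and> a = q \<and> b = p + q)"
    and old: "\<And>p q. 0 < q \<Longrightarrow> q \<le> p \<Longrightarrow> p \<le> n \<Longrightarrow> p \<le> i \<or> p = Suc i \<and> q \<le> j \<Longrightarrow> expanding p q G \<Longrightarrow>
        a * (p + q) \<le> q * b"
    and new: "expanding (Suc i) (Suc j) G \<Longrightarrow> Suc j \<le> Suc i \<Longrightarrow> a * (Suc i + Suc j) \<le> Suc j * b"
  shows "result_inv i (Suc j) a b"
  unfolding result_inv_def
proof (intro conjI allI impI)
  fix p q assume *: "0 < q" "q \<le> p" "p \<le> n" "p \<le> i \<or> p = Suc i \<and> q \<le> Suc j" "expanding p q G"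
  show "a * (p + q) \<le> q * b"
  proof (cases "p = Suc i \<and> q = Suc j")
    case True
    then show ?thesis using * new by simp
  next
    case False
    then have "p \<le> i \<or> p = Suc i \<and> q \<le> j" using *(4) by auto
    with * show ?thesis by (intro old)
  qed
qed (fact assms(1))

lemma result_inv_skip:
  assumes "result_inv i j a b"
    and "\<not> (expanding (Suc i) (Suc j) G \<and> Suc j \<le> Suc i \<and> Suc j * b < a * (Suc i + Suc j))"
  shows "result_inv i (Suc j) a b"
  using result_invD[OF assms(1)] assms(2) by (intro result_inv_step) (blast, blast, meson not_less)

lemma result_inv_update:
  assumes inv: "result_inv i j a b"
    and new: "expanding (Suc i) (Suc j) G" "Suc j \<le> Suc i" "Suc j * b < a * (Suc i + Suc j)"
  shows "result_inv i (Suc j) (Suc j) (Suc i + Suc j)"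
proof -
  have "b > 0" using inv by (auto simp: result_inv_def)
  \<comment> \<open>Transitivity of comparing fractions: the new value is below a/b, and a/b \<le> q
    / (p + q). Multiplying by \<open>b\<close> makes the chain integral.\<close>
  have "Suc j * (p + q) \<le> q * (Suc i + Suc j)" if "a * (p + q) \<le> q * b" for p q
  proof -
    have "b * (Suc j * (p + q)) = (Suc j * b) * (p + q)" by (simp only: ac_simps)
    also have "\<dots> \<le> (a * (Suc i + Suc j)) * (p + q)" using new(3) by (intro mult_le_mono1) simp
    also have "\<dots> = (a * (p + q)) * (Suc i + Suc j)" by (simp only: ac_simps)
    also have "\<dots> \<le> (q * b) * (Suc i + Suc j)" using that by (rule mult_le_mono1)
    also have "\<dots> = b * (q * (Suc i + Suc j))" by (simp only: ac_simps)
    finally show ?thesis using \<open>b > 0\<close> by (simp only: mult_le_cancel1)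
  qed
  then show ?thesis
    using result_invD(2)[OF inv] new(1,2)
    by (intro result_inv_step) (blast, blast, simp)
qed

lemma hoare_capacity_prog:
  "hoare B holds_graph capacity_prog (\<lambda>s. outputs_rational s (tensor_capacity G))"
proof -
  let ?I = "\<lambda>i s. holds_graph s \<and> result_inv i 0 (s ''num'' 0) (s ''den'' 0)"
  let ?J = "\<lambda>i j s. holds_graph s \<and> s ''i'' 0 = i \<and> result_inv i j (s ''num'' 0) (s ''den'' 0)"
  let ?body = "Seq (assign_var ''p'' (Add (var ''i'') (Const 1)))
           (Seq (assign_var ''q'' (Add (var ''j'') (Const 1)))
             (Seq compute_gain update_result))"
  have graph: "holds_graph (s(x := a)) \<longleftrightarrow> holds_graph s" if "x \<noteq> ''n''" "x \<noteq> ''adj''" for s x a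
    using that by (intro holds_graph_cong) auto
  have graph': "holds_graph (set_var x k s) \<longleftrightarrow> holds_graph s" if "x \<noteq> ''n''" "x \<noteq> ''adj''" for s x k
    using that by (intro holds_graph_cong) auto
  have body: "hoare B (\<lambda>s. ?J i j s \<and> s ''j'' 0 = j) ?body (\<lambda>s. ?J i (Suc j) s \<and> s ''j'' 0 = j)"
    if ij: "i < n" "j < n" for i j
  proof (rule hoare_Seq, rule_tac[2] hoare_Seq)
    let ?K = "\<lambda>s. ?J i j s \<and> s ''j'' 0 = j \<and> s ''p'' 0 = Suc i"
    let ?L = "\<lambda>s. ?K s \<and> s ''q'' 0 = Suc j"
    let ?Q = "\<lambda>s. ?J i (Suc j) s \<and> s ''j'' 0 = j"
    show "hoare B (\<lambda>s. ?J i j s \<and> s ''j'' 0 = j) (assign_var ''p'' (Add (var ''i'') (Const 1))) ?K"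
      by (rule hoare_Assign) (use ij le_B in \<open>auto simp: graph\<close>)
    show "hoare B ?K (assign_var ''q'' (Add (var ''j'') (Const 1))) ?L"
      by (rule hoare_Assign) (use ij le_B in \<open>auto simp: graph\<close>)
    show "hoare B ?L (Seq compute_gain update_result) ?Q"
    proof (rule hoare_pointwise)
      fix s0 assume s0: "?L s0"
      let ?M = "\<lambda>s. same_except work_arrays s0 s \<and> (s ''F'' 0 = 0 \<longleftrightarrow> expanding (Suc i) (Suc j) G)"
      have "hoare B (\<lambda>s. s = s0) compute_gain ?M"
        using s0 ij by (intro hoare_compute_gain) auto
      moreover have "hoare B ?M update_result ?Q"
      proof (rule hoare_pointwise)
        fix s1 assume s1: "?M s1"
        have eq: "s1 ''n'' = s0 ''n''" "s1 ''adj'' = s0 ''adj''" "s1 ''i'' = s0 ''i''" "s1 ''j'' = s0 ''j''"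
          "s1 ''p'' = s0 ''p''" "s1 ''q'' = s0 ''q''" "s1 ''num'' = s0 ''num''" "s1 ''den'' = s0 ''den''"
          using s1 by (auto intro!: same_exceptD)
        have L: "?L s1" using s0 eq holds_graph_cong[of s1 s0] by simp
        then have inv: "result_inv i j (s1 ''num'' 0) (s1 ''den'' 0)" by simp
        let ?better = "expanding (Suc i) (Suc j) G \<and> Suc j \<le> Suc i \<and>
          Suc j * s1 ''den'' 0 < s1 ''num'' 0 * (Suc i + Suc j)"
        have skip: "hoare B (\<lambda>s. s = s1 \<and> \<not> ?better) Skip ?Q"
          by (rule hoare_Skip) (use L result_inv_skip[OF inv] in auto)
        have upd: "hoare B (\<lambda>s. s = s1 \<and> ?better)
          (Seq (assign_var ''num'' (var ''q'')) (assign_var ''den'' (Add (var ''p'') (var ''q'')))) ?Q"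
        proof (cases ?better)
          case True
          then have "result_inv i (Suc j) (Suc j) (Suc i + Suc j)"
            using result_inv_update[OF inv] by blast
          then show ?thesis
            by (intro hoare_Seq[where Q = "\<lambda>s. s = set_var ''num'' (Suc j) s1"] hoare_Assign)
              (use L ij le_B in \<open>auto simp: graph graph' set_var_def\<close>)
        next
          case False
          then show ?thesis by (intro hoare_vacuous) simp
        qed
        show "hoare B (\<lambda>s. s = s1) update_result ?Q"
          unfolding update_result_def
          by (intro hoare_Cond; (rule hoare_conseq[OF skip] | rule hoare_conseq[OF upd]))
            (use s1 L in auto)
      qed
      ultimately show "hoare B (\<lambda>s. s = s0) (Seq compute_gain update_result) ?Q"
        by (rule hoare_Seq)
    qed
  qed
  have row: "hoare B (?J i 0) (for_below_n ''j'' ?body) (?J i n)" if i: "i < n" for i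
  proof (rule hoare_for_below_n[where I = "?J i", OF le_B(1)])
    fix j assume j: "j < n"
    show "hoare B (\<lambda>s. ?J i j s \<and> s ''j'' 0 = j \<and> s ''n'' 0 = n) ?body
        (\<lambda>s. ?J i (Suc j) (set_var ''j'' (Suc j) s) \<and> s ''j'' 0 = j \<and> s ''n'' 0 = n)"
      by (rule hoare_conseq[OF body[OF i j]]) (auto simp: graph', simp add: holds_graph_def)
  qed (auto simp: graph', simp add: holds_graph_def)
  have all: "hoare B (?I 0) (for_below_n ''i'' (for_below_n ''j'' ?body)) (?I n)"
  proof (rule hoare_for_below_n[where I = ?I, OF le_B(1)])
    fix i assume i: "i < n"
    show "hoare B (\<lambda>s. ?I i s \<and> s ''i'' 0 = i \<and> s ''n'' 0 = n) (for_below_n ''j'' ?body)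
        (\<lambda>s. ?I (Suc i) (set_var ''i'' (Suc i) s) \<and> s ''i'' 0 = i \<and> s ''n'' 0 = n)"
      by (rule hoare_conseq[OF row[OF i]])
        (auto simp: graph' intro: result_inv_next_row, simp add: holds_graph_def)
  qed (auto simp: graph', simp add: holds_graph_def)
  have out: "outputs_rational s (tensor_capacity G)" if "?I n s" for s
  proof -
    have "s ''den'' 0 \<noteq> 0" using that by (auto simp: result_inv_def)
    moreover have "tensor_capacity G = real (s ''num'' 0) / real (s ''den'' 0)"
      using that by (intro tensor_capacity_eq) (auto simp: result_inv_def)
    ultimately show ?thesis by (simp add: outputs_rational_def)
  qed
  have "hoare B holds_graph capacity_prog (?I n)"
    unfolding capacity_prog_def
  proof (rule hoare_Seq, rule_tac[2] hoare_Seq[OF _ all])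
    show "hoare B holds_graph (assign_var ''num'' (Const 1)) (\<lambda>s. holds_graph s \<and> s ''num'' 0 = 1)"
      by (rule hoare_Assign) (use le_B in \<open>auto simp: graph\<close>)
    show "hoare B (\<lambda>s. holds_graph s \<and> s ''num'' 0 = 1) (assign_var ''den'' (Const 1)) (?I 0)"
      by (rule hoare_Assign) (use le_B result_inv_initial in \<open>auto simp: graph\<close>)
  qed
  then show ?thesis by (rule hoare_conseq) (use out in auto)
qed

lemma holds_graph_input: "holds_graph (graph_input n G)"
  unfolding holds_graph_def graph_input_def
proof (intro conjI allI impI)
  fix u v assume "u < n" "v < n"
  \<comment> \<open>The index must lie inside the matrix; division by \<open>n\<close> with
    remainder then recovers \<open>u\<close> and \<open>v\<close>.\<close>
  then have "u * n + v < Suc u * n" "Suc u * n \<le> n * n"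
    by (simp, intro mult_le_mono1 Suc_leI)
  then have "u * n + v < n * n" by linarith
  with \<open>v < n\<close> show "((\<lambda>_ _. 0)(''n'' := (\<lambda>_. 0)(0 := n), ''adj'' := (\<lambda>i. if i < n * n \<and>
      (i div n, i mod n) \<in> parcs G then 1 else 0))) ''adj'' (u * n + v) =
      (if (u, v) \<in> parcs G then 1 else (0 :: nat))"
    by simp
qed simp

lemma bounded_graph_input: "bounded B (graph_input n G)"
  using le_B(1,2) by (simp add: bounded_def graph_input_def)

end

theorem theorem7:
  shows "\<exists>(c :: prog) (p :: nat poly).
           \<forall>(n :: nat) (G :: nat pair_pre_digraph).
             n \<ge> 1 \<and> pverts G = {..<n} \<and> cograph G \<longrightarrow>
             (\<exists>t s. exec c (graph_input n G) t s \<and> t \<le> poly p n \<and>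
                    outputs_rational s (tensor_capacity G))"
proof (rule exI[of _ capacity_prog], rule exI[of _ "time_bound capacity_prog \<circ>\<^sub>p [:1, 1:]\<^sup>2"],
    intro allI impI)
  fix n :: nat and G :: "nat pair_pre_digraph"
  assume "n \<ge> 1 \<and> pverts G = {..<n} \<and> cograph G"
  then interpret cograph_on n G by unfold_locales auto
  \<comment> \<open>Composition with (1 + x)^2 turns the time bound in \<open>B\<close> into a
    polynomial in \<open>n\<close>.\<close>
  have "B = poly ([:1, 1:]\<^sup>2) n" by (simp add: B_def)
  then show "\<exists>t s. exec capacity_prog (graph_input n G) t s \<and>
      t \<le> poly (time_bound capacity_prog \<circ>\<^sub>p [:1, 1:]\<^sup>2) n \<and>
      outputs_rational s (tensor_capacity G)"
    using hoare_capacity_prog holds_graph_input bounded_graph_input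
    unfolding hoare_def poly_pcompose by metis
qed

end
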